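(* Let $m=m(n)$ be a function of $n$ with $m \le \frac{n}{3}$ and $m \Big/ \left(\frac{(\log\log n)^{3/2}}{(\log n)^{1/2}}\, n\right) \to \infty$ as $n\to\infty$. Then \[ \mathbf{RT}(n,K_4,m) \ge \frac{n^2}{8} + \left(\frac13 - o(1)\right) m n, \] where $o(1)$ denotes a quantity tending to $0$ as $n\to\infty$.
   Context: For a graph $H$ and positive integers $n,m$, the Ramsey–Turán number $\mathbf{RT}(n,H,m)$ is the maximum number of edges in a graph on $n$ vertices with independence number less than $m$ that contains no copy of $H$ as a subgraph. Logarithms are natural. *)

theory Defs
  imports Complex_Main "HOL-Library.Ramsey"
begin

text \<open>
  A finite simple graph is a pair of a finite vertex set and a set of two-element subsets of it;
  \<^const>\<open>nsets\<close> and \<^const>\<open>indep\<close> are those of \<^theory>\<open>HOL-Library.Ramsey\<close>.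
\<close>

type_synonym 'a ugraph = "'a set \<times> 'a set set"

definition verts :: "'a ugraph \<Rightarrow> 'a set" where
  "verts G = fst G"

definition edges :: "'a ugraph \<Rightarrow> 'a set set" where
  "edges G = snd G"

definition simple_graph :: "'a ugraph \<Rightarrow> bool" where
  "simple_graph G \<longleftrightarrow> finite (verts G) \<and> edges G \<subseteq> nsets (verts G) 2"

definition complete_graph :: "nat \<Rightarrow> nat ugraph" where
  "complete_graph k = ({..<k}, nsets {..<k} 2)"

definition contains_copy :: "'a ugraph \<Rightarrow> 'b ugraph \<Rightarrow> bool" where
  "contains_copy G H \<longleftrightarrow>
     (\<exists>f. inj_on f (verts H) \<and> f ` verts H \<subseteq> verts G \<and> (\<forall>e\<in>edges H. f ` e \<in> edges G))"

definition independence_number :: "'a ugraph \<Rightarrow> nat" where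
  "independence_number G = Max {card S | S. S \<subseteq> verts G \<and> indep S (edges G)}"

text \<open>
  The graphs on \<open>n\<close> vertices are taken on the vertex set \<open>{..<n}\<close>, without loss of generality since
  all the notions involved are invariant under isomorphism. If no admissible graph exists, the
  value is the unspecified \<^term>\<open>Max {} :: nat\<close>.
\<close>

definition RT :: "nat \<Rightarrow> 'b ugraph \<Rightarrow> nat \<Rightarrow> nat" where
  "RT n H m = Max {card (edges G) | G :: nat ugraph.
     simple_graph G \<and> verts G = {..<n} \<and> independence_number G < m \<and> \<not> contains_copy G H}"

end

theory Submission
  imports Defs "HOL-Analysis.Convex" "HOL-Real_Asymp.Real_Asymp"
begin

text \<open>
  Let \<open>X\<close> and \<open>Y\<close> be two copies of the grid \<open>{-h..h}\<^sup>k\<close>, every point blown up to the same number of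
  vertices. Two points of the same copy are adjacent if they are almost antipodal,
  \<open>|x + x'|\<^sup>2 < R\<close>, and points of different copies are adjacent if \<open>4 \<langle>x, y\<rangle> \<ge> R\<close>. This discrete
  relative of the Bollobas--Erdos graph contains no \<open>K\<^sub>4\<close> with two vertices in each copy, since
  \<open>\<langle>x + x', y + y'\<rangle> \<le> |x + x'| |y + y'|\<close>, and (once short vectors are ignored) no triangle inside a
  copy. Add two independent hubs of \<open>s = m - o(m)\<close> vertices each, joined completely to each other,
  one joined completely to \<open>X\<close> and the other to \<open>Y\<close>. If the graph between \<open>X\<close> and \<open>Y\<close> has density
  close to \<open>1/2\<close>, the total number of edges is about
  \<open>n\<^sup>2/8 + s n/2 - s\<^sup>2/2 \<ge> n\<^sup>2/8 + s n/3\<close> for \<open>s \<le> n/3\<close>.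

  Independent sets are small by concentration of measure on the grid: a one-dimensional transport
  inequality, which tensorises, shows that a set of density \<open>\<delta>\<close> contains two points with
  \<open>|x + x'|\<^sup>2 = O(h\<^sup>2 log (1/\<delta>))\<close>. The density is close to \<open>1/2\<close> because by the Littlewood--Offord
  inequality \<open>|4 \<langle>x, y\<rangle>| < R\<close> has probability \<open>O(R / (h\<^sup>2 sqrt k))\<close>. Taking \<open>\<delta> = 1 / log n\<close>,
  \<open>h = k\<close> and \<open>k\<close> of order \<open>log n / log log n\<close> makes all errors
  \<open>O((log log n)\<^sup>3\<^sup>/\<^sup>2 / (log n)\<^sup>1\<^sup>/\<^sup>2)\<close>.
\<close>

section \<open>Transport on an interval\<close>

text \<open>Cauchy--Schwarz for the factors \<open>sqrt (s j)\<close> and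
  \<open>e j / sqrt (s j)\<close>. Division by zero gives zero, so \<open>e j\<close> has to vanish
  wherever \<open>s j\<close> does.\<close>

lemma sum_squared_le_sum_div:
  fixes e s :: "'a \<Rightarrow> real"
  assumes "\<And>j. j \<in> A \<Longrightarrow> 0 \<le> s j" and "\<And>j. j \<in> A \<Longrightarrow> s j = 0 \<Longrightarrow> e j = 0"
  shows "(\<Sum>j\<in>A. e j)\<^sup>2 \<le> (\<Sum>j\<in>A. s j) * (\<Sum>j\<in>A. (e j)\<^sup>2 / s j)"
proof -
  have "(\<Sum>j\<in>A. e j) = (\<Sum>j\<in>A. sqrt (s j) * (e j / sqrt (s j)))"
    by (rule sum.cong) (use assms in auto)
  also have "\<dots>\<^sup>2 \<le> (\<Sum>j\<in>A. (sqrt (s j))\<^sup>2) * (\<Sum>j\<in>A. (e j / sqrt (s j))\<^sup>2)"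
    by (rule Cauchy_Schwarz_ineq_sum)
  also have "\<dots> = (\<Sum>j\<in>A. s j) * (\<Sum>j\<in>A. (e j)\<^sup>2 / s j)"
    using assms by (intro arg_cong2[where f="(*)"] sum.cong) (auto simp: power_divide)
  finally show ?thesis .
qed

text \<open>With \<open>s = a + b\<close> and \<open>e = a - b\<close> one has
  \<open>a * b = (s\<^sup>2 - e\<^sup>2) / 4\<close>; completing the square bounds the root, and
  \<open>exp z \<le> 1 + 2 * z\<close> on the unit interval. The product of the two corrections is
  nonpositive and is dropped.\<close>

lemma sqrt_mult_exp_le:
  fixes a b z :: real
  assumes "0 \<le> a" "0 \<le> b" "0 \<le> z" "z \<le> 1"
  shows "sqrt (a * b) * exp z \<le> ((a + b) + 2 * z * (a + b) - (a - b)\<^sup>2 / (2 * (a + b))) / 2"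
proof (cases "a + b = 0")
  case True
  then have "a = 0" "b = 0" using assms by auto
  then show ?thesis by simp
next
  case False
  define s e where "s = a + b" and "e = a - b"
  have s: "s > 0" using False assms by (auto simp: s_def)
  have ab: "a * b = (s\<^sup>2 - e\<^sup>2) / 4" by (simp add: s_def e_def power2_eq_square field_simps)
  have es: "e\<^sup>2 \<le> s\<^sup>2" using ab assms by (metis mult_nonneg_nonneg diff_ge_0_iff_ge zero_le_divide_iff zero_le_numeral not_numeral_le_zero)
  have pos: "0 \<le> (s - e\<^sup>2 / (2 * s)) / 2"
    proof -
    have "e\<^sup>2 \<le> s * (2 * s)" using es zero_le_power2[of s] unfolding power2_eq_square by linarith
    then show ?thesis using s by (simp add: divide_le_eq)
  qed
  have "sqrt (a * b) \<le> (s - e\<^sup>2 / (2 * s)) / 2"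
  proof (rule real_le_lsqrt)
    have "((s - e\<^sup>2 / (2 * s)) / 2)\<^sup>2 = (s\<^sup>2 - e\<^sup>2) / 4 + (e\<^sup>2 / (2 * s))\<^sup>2 / 4"
      using s by (simp add: power2_eq_square field_simps)
    then show "a * b \<le> ((s - e\<^sup>2 / (2 * s)) / 2)\<^sup>2" unfolding ab by simp
  qed (use pos assms in auto)
  moreover have "exp z \<le> 1 + 2 * z"
    using exp_bound[of z] assms by (smt (verit) power2_eq_square mult_left_le)
  ultimately have "sqrt (a * b) * exp z \<le> ((s - e\<^sup>2 / (2 * s)) / 2) * (1 + 2 * z)"
    using pos assms by (intro mult_mono) auto
  also have "\<dots> = (s + 2 * z * s - e\<^sup>2 / (2 * s)) / 2 - z * (e\<^sup>2 / (2 * s))"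
    by (simp add: algebra_simps add_divide_distrib diff_divide_distrib)
  also have "\<dots> \<le> (s + 2 * z * s - e\<^sup>2 / (2 * s)) / 2"
  proof -
    have "0 \<le> z * (e\<^sup>2 / (2 * s))" using assms s by simp
    then show ?thesis by linarith
  qed
  finally show ?thesis by (simp add: s_def e_def)
qed

text \<open>
  For \<open>d = x - y\<close> the square root loses the Dirichlet energy of \<open>d\<close> to second order, and by the
  Cauchy--Schwarz inequality this pays for the gain \<open>exp (d\<^sup>2 / (16 L\<^sup>2))\<close>.
\<close>

lemma monotone_path_energy:
  fixes x y :: "nat \<Rightarrow> real"
  assumes "mono x" "mono y" "x 0 = 0" "y 0 = 0" "x r = L" "y r = L" "L > 0"
  shows "(\<Sum>k<r. sqrt ((x (Suc k) - x k) * (y (Suc k) - y k)) * exp ((x k - y k)\<^sup>2 / (16 * L\<^sup>2))) \<le> L"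
proof -
  define a b where "a k = x (Suc k) - x k" and "b k = y (Suc k) - y k" for k
  define s e where "s k = a k + b k" and "e k = a k - b k" for k
  define E where "E = (\<Sum>k<r. (e k)\<^sup>2 / s k)"
  define z where "z k = (x k - y k)\<^sup>2 / (16 * L\<^sup>2)" for k
  have ab: "0 \<le> a k" "0 \<le> b k" for k
    using assms(1,2) by (auto simp: a_def b_def mono_def)
  have s0: "0 \<le> s k" for k using ab by (simp add: s_def)
  have e0: "e k = 0" if "s k = 0" for k using that ab[of k] by (auto simp: s_def e_def)
  have sums: "(\<Sum>k<r. s k) = 2 * L"
    using assms by (simp add: s_def a_def b_def sum.distrib sum_lessThan_telescope)
  have d: "x k - y k = (\<Sum>j<k. e j)" for k
  proof -
    have "(\<Sum>j<k. e j) = (\<Sum>j<k. x (Suc j) - x j) - (\<Sum>j<k. y (Suc j) - y j)"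
      by (simp add: e_def a_def b_def sum_subtractf)
    then show ?thesis using assms(3,4) by (simp only: sum_lessThan_telescope)
  qed
  have dE: "(x k - y k)\<^sup>2 \<le> 2 * L * E" if "k < r" for k
  proof -
    have "(x k - y k)\<^sup>2 \<le> (\<Sum>j<k. s j) * (\<Sum>j<k. (e j)\<^sup>2 / s j)"
      unfolding d by (rule sum_squared_le_sum_div) (use s0 e0 in auto)
    also have "\<dots> \<le> (\<Sum>j<r. s j) * (\<Sum>j<r. (e j)\<^sup>2 / s j)"
      using that s0 by (intro mult_mono sum_mono2 sum_nonneg) auto
    finally show ?thesis by (simp add: sums E_def)
  qed
  \<comment> \<open>This keeps \<open>z k\<close> at most 1, within the range of the linear bound
    for \<open>exp\<close>.\<close>
  have dL: "(x k - y k)\<^sup>2 \<le> L\<^sup>2" if "k < r" for k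
  proof -
    have "0 \<le> x k" "x k \<le> L" "0 \<le> y k" "y k \<le> L"
      using assms monoD[OF assms(1), of 0 k] monoD[OF assms(1), of k r]
        monoD[OF assms(2), of 0 k] monoD[OF assms(2), of k r] that by auto
    then have "\<bar>x k - y k\<bar> \<le> \<bar>L\<bar>" by auto
    then show ?thesis by (simp add: abs_le_square_iff)
  qed
  have "(\<Sum>k<r. sqrt (a k * b k) * exp (z k))
      \<le> (\<Sum>k<r. (s k + 2 * z k * s k - (e k)\<^sup>2 / (2 * s k)) / 2)"
  proof (rule sum_mono)
    fix k assume "k \<in> {..<r}"
    then have "(x k - y k)\<^sup>2 \<le> 16 * L\<^sup>2"
      using dL[of k] zero_le_power2[of L] unfolding lessThan_iff by linarith
    then have "z k \<le> 1" "0 \<le> z k"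
      using \<open>L > 0\<close> by (auto simp: z_def)
    then show "sqrt (a k * b k) * exp (z k) \<le> (s k + 2 * z k * s k - (e k)\<^sup>2 / (2 * s k)) / 2"
      unfolding s_def e_def using ab by (intro sqrt_mult_exp_le) auto
  qed
  also have "\<dots> \<le> (\<Sum>k<r. (s k + E / (4 * L) * s k - (e k)\<^sup>2 / s k / 2) / 2)"
  proof (rule sum_mono)
    fix k assume "k \<in> {..<r}"
    then have "2 * z k \<le> 2 * (2 * L * E / (16 * L\<^sup>2))"
      using dE[of k] assms unfolding z_def by (intro mult_left_mono divide_right_mono) auto
    also have "\<dots> = E / (4 * L)" using assms by (simp add: power2_eq_square)
    finally have "2 * z k * s k \<le> E / (4 * L) * s k" by (rule mult_right_mono) (rule s0)
    moreover have "(e k)\<^sup>2 / (2 * s k) = (e k)\<^sup>2 / s k / 2" by simp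
    ultimately show "(s k + 2 * z k * s k - (e k)\<^sup>2 / (2 * s k)) / 2
      \<le> (s k + E / (4 * L) * s k - (e k)\<^sup>2 / s k / 2) / 2"
      by (intro divide_right_mono) auto
  qed
  \<comment> \<open>As \<open>s\<close> sums to \<open>2 * L\<close>, the gain is
    \<open>E / (4 * L) * (2 * L) = E / 2\<close>, exactly the energy lost; the 16 in the exponent is
    chosen for this.\<close>
  also have "\<dots> = ((\<Sum>k<r. s k) + E / (4 * L) * (\<Sum>k<r. s k) - E / 2) / 2"
  proof -
    have "(\<Sum>k<r. (e k)\<^sup>2 / s k / 2) = E / 2" by (simp only: E_def sum_divide_distrib)
    then show ?thesis
      by (simp only: sum.distrib sum_subtractf flip: sum_divide_distrib[where r = 2] sum_distrib_left)
  qed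
  also have "\<dots> = L" using assms by (simp add: sums)
  finally show ?thesis by (simp add: a_def b_def z_def)
qed

text \<open>The inverse of the piecewise linear function with slope \<open>p i\<close> on the
  \<open>i\<close>-th unit interval. Written as a sum of ramps clamped to [0, 1] it is monotone term
  by term; on the \<open>i\<close>-th piece the earlier ramps are 1 and the later ones 0.\<close>

lemma piecewise_linear_inverse_cdf:
  fixes p :: "nat \<Rightarrow> real"
  assumes "\<And>i. i < L \<Longrightarrow> p i > 0"
  obtains x where "mono x"
    and "\<And>i t. i < L \<Longrightarrow> (\<Sum>j<i. p j) \<le> t \<Longrightarrow> t \<le> (\<Sum>j<Suc i. p j) \<Longrightarrow>
      x t = real i + (t - (\<Sum>j<i. p j)) / p i"
proof
  define P where "P i = (\<Sum>j<i. p j)" for i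
  define x where "x t = (\<Sum>i<L. max 0 (min 1 ((t - P i) / p i)))" for t
  show "mono x"
    unfolding x_def
    by (intro monoI sum_mono max.mono min.mono divide_right_mono) (use assms in \<open>auto intro: less_imp_le\<close>)
  have Pm: "P i \<le> P j" if "i \<le> j" "j \<le> L" for i j
    unfolding P_def using that by (intro sum_mono2) (auto intro!: less_imp_le[OF assms])
  show "x t = real i + (t - (\<Sum>j<i. p j)) / p i"
    if i: "i < L" and t: "(\<Sum>j<i. p j) \<le> t" "t \<le> (\<Sum>j<Suc i. p j)" for i t
  proof -
    have t: "P i \<le> t" "t \<le> P (Suc i)" using t by (auto simp: P_def)
    have lo: "max 0 (min 1 ((t - P j) / p j)) = 1" if "j < i" for j
    proof -
      have "P (Suc j) \<le> t" using Pm[of "Suc j" i] that t i by auto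
      then have "p j \<le> t - P j" by (simp add: P_def)
      then show ?thesis using assms[of j] that i by simp
    qed
    have hi: "max 0 (min 1 ((t - P j) / p j)) = 0" if "i < j" "j < L" for j
    proof -
      have "t - P j \<le> 0" using Pm[of "Suc i" j] that t i by auto
      then have "(t - P j) / p j \<le> 0" using assms[of j] that by (simp add: divide_le_0_iff)
      then show ?thesis by simp
    qed
    have mid: "max 0 (min 1 ((t - P i) / p i)) = (t - P i) / p i"
    proof -
      have "t - P i \<le> p i" using t by (simp add: P_def)
      then show ?thesis using assms[of i] i t by simp
    qed
    have split: "{..<L} = {..<i} \<union> ({i} \<union> {i<..<L})" using i by auto
    have "x t = (\<Sum>j<i. max 0 (min 1 ((t - P j) / p j))) + (max 0 (min 1 ((t - P i) / p i))
        + (\<Sum>j\<in>{i<..<L}. max 0 (min 1 ((t - P j) / p j))))"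
      unfolding x_def split by (subst sum.union_disjoint) auto
    also have "\<dots> = real i + ((t - P i) / p i + 0)"
      unfolding mid using lo hi by (intro arg_cong2[where f="(+)"]) auto
    finally show ?thesis by (simp add: P_def)
  qed
qed

text \<open>
  The slack \<open>1\<close> is the rounding error of the grid; without it the transport inequality fails for
  functions that vary little between neighbouring points.
\<close>

definition slack_cost :: "real \<Rightarrow> real \<Rightarrow> real" where
  "slack_cost L d = (max 0 (\<bar>d\<bar> - 1))\<^sup>2 / (8 * L\<^sup>2)"

lemma slack_cost_nonneg: "0 \<le> slack_cost L d"
  by (simp add: slack_cost_def)

text \<open>
  The monotone rearrangement of \<open>u\<close> into \<open>v\<close> traces a monotone path from \<open>(0, 0)\<close> to \<open>(L, L)\<close>. On a
  piece of it inside a single cell \<open>(i, j)\<close> with increments \<open>a\<close> and \<open>b\<close>, the transported mass fraction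
  times \<open>sqrt (sum u * sum v)\<close> is \<open>sqrt (a b u\<^sub>i v\<^sub>j)\<close>.
\<close>

lemma interval_transport_pos:
  fixes u v :: "nat \<Rightarrow> real"
  assumes L: "L > 0" and u: "\<And>i. i < L \<Longrightarrow> u i > 0" and v: "\<And>i. i < L \<Longrightarrow> v i > 0"
    and uv: "\<And>i j. i < L \<Longrightarrow> j < L \<Longrightarrow> u i * v j \<le> exp (slack_cost L (real i - real j))"
  shows "(\<Sum>i<L. u i) * (\<Sum>i<L. v i) \<le> (real L)\<^sup>2"
proof -
  define I J where "I = (\<Sum>i<L. u i)" and "J = (\<Sum>i<L. v i)"
  have I: "I > 0" unfolding I_def by (rule sum_pos) (use L u in auto)
  have J: "J > 0" unfolding J_def by (rule sum_pos) (use L v in auto)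
  define p q where "p i = u i / I" and "q i = v i / J" for i
  define P Q where "P i = (\<Sum>j<i. p j)" and "Q i = (\<Sum>j<i. q j)" for i
  have p: "p i > 0" and q: "q i > 0" if "i < L" for i
    using u[OF that] v[OF that] I J by (auto simp: p_def q_def)
  have PL: "P L = 1" "Q L = 1" "P 0 = 0" "Q 0 = 0"
    using I J by (auto simp: P_def Q_def p_def q_def I_def J_def simp flip: sum_divide_distrib)
  have PQ: "P i \<le> P j" "Q i \<le> Q j" if "i \<le> j" "j \<le> L" for i j
    unfolding P_def Q_def using that
    by (auto intro!: sum_mono2 less_imp_le[OF p] less_imp_le[OF q])
  obtain x where x: "mono x" 
    and xi: "\<And>i t. i < L \<Longrightarrow> P i \<le> t \<Longrightarrow> t \<le> P (Suc i) \<Longrightarrow> x t = real i + (t - P i) / p i"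
    using piecewise_linear_inverse_cdf[of L p] p unfolding P_def by blast
  obtain y where y: "mono y"
    and yi: "\<And>i t. i < L \<Longrightarrow> Q i \<le> t \<Longrightarrow> t \<le> Q (Suc i) \<Longrightarrow> y t = real i + (t - Q i) / q i"
    using piecewise_linear_inverse_cdf[of L q] q unfolding Q_def by blast
  \<comment> \<open>The common refinement of both partitions: between consecutive breakpoints
    \<open>x\<close> and \<open>y\<close> are linear and the path stays in one cell
    \<open>(i, j)\<close>.\<close>
  define T where "T = P ` {..L} \<union> Q ` {..L}"
  define ts where "ts = sorted_list_of_set T"
  have finT: "finite T" by (simp add: T_def)
  have T01: "0 \<in> T" "1 \<in> T" using PL by (auto simp: T_def intro: image_eqI[of _ _ 0] image_eqI[of _ _ L])
  have Tb: "0 \<le> t \<and> t \<le> 1" if "t \<in> T" for t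
    using that PQ[of 0] PQ[of _ L] PL by (auto simp: T_def)
  have ts: "sorted ts" "distinct ts" "set ts = T" using finT by (auto simp: ts_def)
  define r where "r = length ts - 1"
  have len: "length ts = Suc r" using T01 ts(3) by (cases ts) (auto simp: r_def)
  have nth_mono: "ts ! i \<le> ts ! j" if "i \<le> j" "j \<le> r" for i j
    using ts(1) that len by (auto intro: sorted_nth_mono)
  have first: "ts ! 0 = 0"
  proof -
    obtain i where "i < length ts" "ts ! i = 0" using T01 ts(3) by (metis in_set_conv_nth)
    then have "ts ! 0 \<le> 0" using nth_mono[of 0 i] len by auto
    moreover have "ts ! 0 \<ge> 0" using Tb ts(3) len by (metis nth_mem zero_less_Suc)
    ultimately show ?thesis by simp
  qed
  have last: "ts ! r = 1"
  proof -
    obtain i where "i < length ts" "ts ! i = 1" using T01 ts(3) by (metis in_set_conv_nth)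
    then have "ts ! r \<ge> 1" using nth_mono[of i r] len by auto
    moreover have "ts ! r \<le> 1" using Tb ts(3) len by (metis nth_mem lessI)
    ultimately show ?thesis by simp
  qed
  have gap: "t \<le> ts ! k \<or> ts ! Suc k \<le> t" if t: "t \<in> T" and k: "k < r" for t k
  proof -
    obtain i where i: "i < length ts" "ts ! i = t" using t ts(3) by (metis in_set_conv_nth)
    show ?thesis
    proof (cases "i \<le> k")
      case True then show ?thesis using nth_mono[of i k] i k by auto
    next
      case False then show ?thesis using nth_mono[of "Suc k" i] i k len by auto
    qed
  qed
  \<comment> \<open>Used for \<open>F = P\<close> and \<open>F = Q\<close>. The greatest index with
    \<open>F i \<le> ts ! k\<close> works, as no breakpoint lies strictly between
    \<open>ts ! k\<close> and \<open>ts ! Suc k\<close>.\<close>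
  have cell: "\<exists>i<L. F i \<le> ts ! k \<and> ts ! Suc k \<le> F (Suc i)"
    if F: "F ` {..L} \<subseteq> T" "F 0 = 0" "F L = 1" and k: "k < r" for F k
  proof -
    define i where "i = (GREATEST i. i \<le> L \<and> F i \<le> ts ! k)"
    have k0: "0 \<le> ts ! k" using nth_mono[of 0 k] first k by auto
    have i: "i \<le> L \<and> F i \<le> ts ! k"
      unfolding i_def by (rule GreatestI_nat[of _ 0 L]) (use F k0 in auto)
    have "ts ! k < ts ! Suc k" using ts k len
      by (metis Suc_less_eq n_not_Suc_n nth_eq_iff_index_eq nth_mono less_eq_real_def less_SucI lessI less_imp_le Suc_leI)
    also have "\<dots> \<le> 1" using nth_mono[of "Suc k" r] last k by auto
    finally have "i \<noteq> L" using i F(3) by auto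
    then have iL: "i < L" using i by auto
    have "\<not> F (Suc i) \<le> ts ! k"
    proof
      assume "F (Suc i) \<le> ts ! k"
      then have "Suc i \<le> i" unfolding i_def[symmetric]
        using Greatest_le_nat[of "\<lambda>i. i \<le> L \<and> F i \<le> ts ! k" "Suc i" L] iL i_def by auto
      then show False by simp
    qed
    moreover have "F (Suc i) \<in> T" using F(1) iL by auto
    ultimately have "ts ! Suc k \<le> F (Suc i)" using gap[of "F (Suc i)" k] k by auto
    then show ?thesis using i iL by auto
  qed
  \<comment> \<open>Capping the index at \<open>r\<close> makes the sequences monotone on all
    natural numbers, as \<open>monotone_path_energy\<close> requires.\<close>
  define X Y where "X k = x (ts ! min k r)" and "Y k = y (ts ! min k r)" for k
  have mX: "mono X" "mono Y" unfolding X_def Y_def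
    by (auto intro!: monoI monoD[OF x] monoD[OF y] nth_mono)
  have ends: "x 0 = 0" "y 0 = 0" "x 1 = L" "y 1 = L"
  proof -
    have *: "Suc (L - 1) = L" using L by simp
    show "x 0 = 0" using xi[of 0 0] L PL PQ[of 0 "Suc 0"] by auto
    show "y 0 = 0" using yi[of 0 0] L PL PQ[of 0 "Suc 0"] by auto
    have "P L = P (L-1) + p (L-1)" "Q L = Q (L-1) + q (L-1)"
      unfolding P_def Q_def by (subst (1) *[symmetric], simp)+
    then show "x 1 = L" "y 1 = L"
      using xi[of "L-1" 1] yi[of "L-1" 1] L PL PQ[of "L-1" L] p[of "L-1"] q[of "L-1"] *
      by (auto simp: of_nat_diff)
  qed
  have step: "(ts ! Suc k - ts ! k) * sqrt (I * J)
      \<le> sqrt ((X (Suc k) - X k) * (Y (Suc k) - Y k)) * exp ((X k - Y k)\<^sup>2 / (16 * (real L)\<^sup>2))"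
    if k: "k < r" for k
  proof -
    define t t' where "t = ts ! k" and "t' = ts ! Suc k"
    have tt: "t \<le> t'" using nth_mono[of k "Suc k"] k by (auto simp: t_def t'_def)
    obtain i where i: "i < L" "P i \<le> t" "t' \<le> P (Suc i)"
      using cell[of P k] k PL by (auto simp: T_def t_def t'_def)
    obtain j where j: "j < L" "Q j \<le> t" "t' \<le> Q (Suc j)"
      using cell[of Q k] k PL by (auto simp: T_def t_def t'_def)
    have X: "X k = x t" "X (Suc k) = x t'" "Y k = y t" "Y (Suc k) = y t'"
      using k by (auto simp: X_def Y_def t_def t'_def min_def)
    have dX: "X (Suc k) - X k = (t' - t) * I / u i" "Y (Suc k) - Y k = (t' - t) * J / v j"
      using xi[of i t] xi[of i t'] yi[of j t] yi[of j t'] i j tt u[of i] v[of j] I J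
      unfolding X p_def q_def by (auto simp: field_simps)
    have bX: "real i \<le> X k" "X k \<le> real i + 1" "real j \<le> Y k" "Y k \<le> real j + 1"
    proof -
      have "t - P i \<le> p i" "t - Q j \<le> q j" using i j tt by (auto simp: P_def Q_def)
      then show "real i \<le> X k" "X k \<le> real i + 1" "real j \<le> Y k" "Y k \<le> real j + 1"
        using xi[of i t] yi[of j t] i j tt p[of i] q[of j] unfolding X by auto
    qed
    \<comment> \<open>The path point lies in the unit square with lower corner
      \<open>(i, j)\<close>, so \<open>X k - Y k\<close> differs from \<open>i - j\<close> by at
      most 1, which the slack absorbs.\<close>
    have "max 0 (\<bar>real i - real j\<bar> - 1) \<le> \<bar>X k - Y k\<bar>" using bX by auto
    then have "(max 0 (\<bar>real i - real j\<bar> - 1))\<^sup>2 \<le> (X k - Y k)\<^sup>2"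
      by (metis max.cobounded1 power2_abs power_mono)
    then have "slack_cost L (real i - real j) / 2 \<le> (X k - Y k)\<^sup>2 / (8 * (real L)\<^sup>2) / 2"
      unfolding slack_cost_def by (intro divide_right_mono) auto
    then have c: "slack_cost L (real i - real j) / 2 \<le> (X k - Y k)\<^sup>2 / (16 * (real L)\<^sup>2)" by simp
    have "sqrt (u i * v j) \<le> sqrt (exp (slack_cost L (real i - real j)))"
      using uv[OF i(1) j(1)] by simp
    \<comment> \<open>The root halves the exponent, which turns the 8 of \<open>slack_cost\<close>
      into the 16 of \<open>monotone_path_energy\<close>.\<close>
    also have "\<dots> = exp (slack_cost L (real i - real j) / 2)"
      by (rule real_sqrt_unique) (auto simp: power2_eq_square simp flip: exp_add)
    also have "\<dots> \<le> exp ((X k - Y k)\<^sup>2 / (16 * (real L)\<^sup>2))" using c by simp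
    finally have uv': "sqrt (u i * v j) \<le> exp ((X k - Y k)\<^sup>2 / (16 * (real L)\<^sup>2))" .
    have "(X (Suc k) - X k) * (Y (Suc k) - Y k) * (u i * v j) = (t' - t)\<^sup>2 * (I * J)"
      unfolding dX using u[OF i(1)] v[OF j(1)] by (simp add: power2_eq_square)
    then have "sqrt ((X (Suc k) - X k) * (Y (Suc k) - Y k)) * sqrt (u i * v j) = (t' - t) * sqrt (I * J)"
      using tt by (simp flip: real_sqrt_mult add: real_sqrt_mult[of "(t'-t)\<^sup>2"])
    then have "(t' - t) * sqrt (I * J) = sqrt ((X (Suc k) - X k) * (Y (Suc k) - Y k)) * sqrt (u i * v j)" by simp
    also have "\<dots> \<le> sqrt ((X (Suc k) - X k) * (Y (Suc k) - Y k)) * exp ((X k - Y k)\<^sup>2 / (16 * (real L)\<^sup>2))"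
      using uv' mX by (intro mult_left_mono) (auto simp: mono_def)
    finally show ?thesis by (simp add: t_def t'_def)
  qed
  have "sqrt (I * J) = (\<Sum>k<r. (ts ! Suc k - ts ! k) * sqrt (I * J))"
    using sum_lessThan_telescope[of "\<lambda>k. ts ! k" r] by (simp add: first last flip: sum_distrib_right)
  also have "\<dots> \<le> (\<Sum>k<r. sqrt ((X (Suc k) - X k) * (Y (Suc k) - Y k)) * exp ((X k - Y k)\<^sup>2 / (16 * (real L)\<^sup>2)))"
    by (rule sum_mono) (use step in auto)
  also have "\<dots> \<le> real L"
    by (rule monotone_path_energy, rule mX, rule mX) ( use ends first last L in \<open>simp_all add: X_def Y_def\<close>)
  finally have "(sqrt (I * J))\<^sup>2 \<le> (real L)\<^sup>2" using I J by (intro power_mono) auto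
  then show ?thesis using I J by (simp add: I_def J_def)
qed

text \<open>The concentration argument uses multiples of indicator functions, which have zeros;
  hence the passage from positive to nonnegative functions.\<close>

lemma interval_transport:
  fixes u v :: "nat \<Rightarrow> real"
  assumes L: "L > 0" and u: "\<And>i. i < L \<Longrightarrow> u i \<ge> 0" and v: "\<And>i. i < L \<Longrightarrow> v i \<ge> 0"
    and uv: "\<And>i j. i < L \<Longrightarrow> j < L \<Longrightarrow> u i * v j \<le> exp (slack_cost L (real i - real j))"
  shows "(\<Sum>i<L. u i) * (\<Sum>i<L. v i) \<le> (real L)\<^sup>2"
proof -
  \<comment> \<open>Raising \<open>u\<close> and \<open>v\<close> to small positive values keeps the hypothesis, because the cost is nonnegative.\<close>
  define a where "a = 1 / (1 + (\<Sum>i<L. v i))"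
  define u' where "u' i = max a (u i)" for i
  \<comment> \<open>\<open>b\<close> is chosen after \<open>u'\<close>, so that the new products
    \<open>u' i * b\<close> also stay below \<open>1 \<le> exp (slack_cost L d)\<close>.\<close>
  define b where "b = 1 / (1 + (\<Sum>i<L. u' i))"
  define v' where "v' i = max b (v i)" for i
  have e1: "1 \<le> exp (slack_cost L d)" for d by (simp add: slack_cost_nonneg)
  have "0 \<le> (\<Sum>i<L. v i)" by (rule sum_nonneg) (use v in auto)
  then have a: "a > 0" by (simp add: a_def)
  have u': "u' i > 0" for i using a by (simp add: u'_def less_max_iff_disj)
  have "0 \<le> (\<Sum>i<L. u' i)" by (rule sum_nonneg) (use u' in \<open>auto intro: less_imp_le\<close>)
  then have b: "b > 0" by (simp add: b_def)
  have v': "v' i > 0" for i using b by (simp add: v'_def less_max_iff_disj)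
  have av: "a * v j \<le> 1" if "j < L" for j
  proof -
    have "v j \<le> (\<Sum>i<L. v i)" by (rule member_le_sum) (use that v in auto)
    then show ?thesis using \<open>0 \<le> (\<Sum>i<L. v i)\<close> by (simp add: a_def divide_le_eq)
  qed
  have bu: "u' j * b \<le> 1" if "j < L" for j
  proof -
    have "u' j \<le> (\<Sum>i<L. u' i)" by (rule member_le_sum) (use that u' in \<open>auto intro: less_imp_le\<close>)
    then show ?thesis using \<open>0 \<le> (\<Sum>i<L. u' i)\<close> by (simp add: b_def divide_le_eq)
  qed
  have "(\<Sum>i<L. u' i) * (\<Sum>i<L. v' i) \<le> (real L)\<^sup>2"
  proof (rule interval_transport_pos[OF L])
    fix i j assume ij: "i < L" "j < L"
    have "u' i * v j \<le> exp (slack_cost L (real i - real j))"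
      using uv[OF ij] order_trans[OF av[OF ij(2)] e1[of "real i - real j"]] by (auto simp: u'_def max_def)
    then show "u' i * v' j \<le> exp (slack_cost L (real i - real j))"
      using order_trans[OF bu[OF ij(1)] e1[of "real i - real j"]] by (auto simp: v'_def max_def)
  qed (use u' v' in auto)
  moreover have "(\<Sum>i<L. u i) * (\<Sum>i<L. v i) \<le> (\<Sum>i<L. u' i) * (\<Sum>i<L. v' i)"
    by (intro mult_mono sum_mono sum_nonneg) (use u v u' in \<open>auto simp: u'_def v'_def le_max_iff_disj\<close>)
  ultimately show ?thesis by simp
qed

section \<open>Concentration on the grid\<close>

lemma sum_PiE_insert:
  assumes "a \<notin> I"
  shows "(\<Sum>x\<in>Pi\<^sub>E (insert a I) S. f x) = (\<Sum>s\<in>S a. \<Sum>x\<in>Pi\<^sub>E I S. f (x(a := s)))"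
  unfolding PiE_insert_eq
  by (subst sum.reindex[OF inj_combinator[OF assms]])
     (simp add: sum.cartesian_product o_def case_prod_unfold)

text \<open>Tensorisation as for the Prekopa--Leindler inequality: with the coordinate
  \<open>a\<close> split off, the induction hypothesis bounds the slice sums by
  \<open>U s * V t \<le> exp (w s t) * d\<^sup>2\<close>, and the one-dimensional case applies to
  \<open>U s / d\<close> and \<open>V s / d\<close>.\<close>

lemma transport_tensor:
  fixes w :: "'b \<Rightarrow> 'b \<Rightarrow> real" and u v :: "('a \<Rightarrow> 'b) \<Rightarrow> real"
  assumes base: "\<And>u v. (\<And>s. s \<in> S \<Longrightarrow> 0 \<le> u s) \<Longrightarrow> (\<And>s. s \<in> S \<Longrightarrow> 0 \<le> v s) \<Longrightarrow>
      (\<And>s t. s \<in> S \<Longrightarrow> t \<in> S \<Longrightarrow> u s * v t \<le> exp (w s t)) \<Longrightarrow>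
      (\<Sum>s\<in>S. u s) * (\<Sum>s\<in>S. v s) \<le> c\<^sup>2"
    and c: "c > 0" and I: "finite I"
    and "\<And>x. x \<in> Pi\<^sub>E I (\<lambda>_. S) \<Longrightarrow> 0 \<le> u x" "\<And>x. x \<in> Pi\<^sub>E I (\<lambda>_. S) \<Longrightarrow> 0 \<le> v x"
    and "\<And>x y. x \<in> Pi\<^sub>E I (\<lambda>_. S) \<Longrightarrow> y \<in> Pi\<^sub>E I (\<lambda>_. S) \<Longrightarrow>
      u x * v y \<le> exp (\<Sum>i\<in>I. w (x i) (y i))"
  shows "(\<Sum>x\<in>Pi\<^sub>E I (\<lambda>_. S). u x) * (\<Sum>x\<in>Pi\<^sub>E I (\<lambda>_. S). v x) \<le> (c ^ card I)\<^sup>2"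
  using I assms(4-6)
proof (induction I arbitrary: u v rule: finite_induct)
  case empty
  then show ?case by simp
next
  case (insert a I u v)
  define U where "U s = (\<Sum>x\<in>Pi\<^sub>E I (\<lambda>_. S). u (x(a := s)))" for s
  define V where "V s = (\<Sum>x\<in>Pi\<^sub>E I (\<lambda>_. S). v (x(a := s)))" for s
  define d where "d = c ^ card I"
  have d: "d > 0" using c by (simp add: d_def)
  have upd: "x(a := s) \<in> Pi\<^sub>E (insert a I) (\<lambda>_. S)" if "x \<in> Pi\<^sub>E I (\<lambda>_. S)" "s \<in> S" for x s
    using that by (auto simp: PiE_insert_eq)
  have U0: "0 \<le> U s" and V0: "0 \<le> V s" if "s \<in> S" for s
    unfolding U_def V_def
    by (auto intro!: sum_nonneg insert.prems(1,2)[OF upd] that simp del: fun_upd_apply)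
  have UV: "U s * V t \<le> exp (w s t) * d\<^sup>2" if st: "s \<in> S" "t \<in> S" for s t
  proof -
    \<comment> \<open>The factor \<open>exp (- w s t)\<close> cancels the cost of the coordinate
      \<open>a\<close>, so that exactly the cost over \<open>I\<close> remains.\<close>
    have "(\<Sum>x\<in>Pi\<^sub>E I (\<lambda>_. S). u (x(a := s))) * (\<Sum>x\<in>Pi\<^sub>E I (\<lambda>_. S). exp (- w s t) * v (x(a := t))) \<le> d\<^sup>2"
      unfolding d_def
    proof (rule insert.IH)
      fix x y assume xy: "x \<in> Pi\<^sub>E I (\<lambda>_. S)" "y \<in> Pi\<^sub>E I (\<lambda>_. S)"
      have "u (x(a := s)) * v (y(a := t)) \<le> exp (\<Sum>i\<in>insert a I. w ((x(a := s)) i) ((y(a := t)) i))"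
        using upd xy st by (intro insert.prems(3))
      also have "(\<Sum>i\<in>insert a I. w ((x(a := s)) i) ((y(a := t)) i)) = w s t + (\<Sum>i\<in>I. w (x i) (y i))"
      proof -
        have "(\<Sum>i\<in>I. w ((x(a := s)) i) ((y(a := t)) i)) = (\<Sum>i\<in>I. w (x i) (y i))"
          using insert.hyps by (intro sum.cong) auto
        then show ?thesis using insert.hyps by simp
      qed
      finally have "exp (- w s t) * (u (x(a := s)) * v (y(a := t)))
          \<le> exp (- w s t) * exp (w s t + (\<Sum>i\<in>I. w (x i) (y i)))"
        by (rule mult_left_mono) simp
      moreover have "exp (- w s t) * exp (w s t + (\<Sum>i\<in>I. w (x i) (y i))) = exp (\<Sum>i\<in>I. w (x i) (y i))"
        by (simp flip: exp_add)
      ultimately show "u (x(a := s)) * (exp (- w s t) * v (y(a := t))) \<le> exp (\<Sum>i\<in>I. w (x i) (y i))"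
        by (simp only: mult_ac)
    qed (use st in \<open>auto intro!: mult_nonneg_nonneg insert.prems(1,2)[OF upd] simp del: fun_upd_apply\<close>)
    then have "exp (- w s t) * (U s * V t) \<le> d\<^sup>2"
      by (simp add: U_def V_def mult_ac flip: sum_distrib_left)
    then show ?thesis by (simp add: exp_minus field_simps)
  qed
  have "(\<Sum>s\<in>S. U s / d) * (\<Sum>s\<in>S. V s / d) \<le> c\<^sup>2"
    using d UV U0 V0 by (intro base) (auto simp: power2_eq_square field_simps)
  then have "(\<Sum>s\<in>S. U s) * (\<Sum>s\<in>S. V s) \<le> c\<^sup>2 * d\<^sup>2"
    using d by (simp add: power2_eq_square field_simps flip: sum_divide_distrib)
  moreover have "(\<Sum>x\<in>Pi\<^sub>E (insert a I) (\<lambda>_. S). u x) = (\<Sum>s\<in>S. U s)"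
      "(\<Sum>x\<in>Pi\<^sub>E (insert a I) (\<lambda>_. S). v x) = (\<Sum>s\<in>S. V s)"
    using insert.hyps by (simp_all add: sum_PiE_insert U_def V_def)
  ultimately show ?case using insert.hyps by (simp add: d_def power_mult_distrib)
qed

section \<open>The grid and its sign flips\<close>

definition grid :: "nat \<Rightarrow> nat \<Rightarrow> (nat \<Rightarrow> int) set" where
  "grid h k = Pi\<^sub>E {..<k} (\<lambda>_. {- int h..int h})"

lemma finite_grid [simp]: "finite (grid h k)"
  unfolding grid_def by (intro finite_PiE) auto

lemma card_grid: "card (grid h k) = (2 * h + 1) ^ k"
  unfolding grid_def by (subst card_PiE) (auto simp: nat_add_distrib nat_mult_distrib algebra_simps)

text \<open>Grid points are extensional functions, so negation is expressed as the flip of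
  \<open>{..<k}\<close>; a flip outside that set could disturb the value
  \<open>undefined\<close>.\<close>

definition flip :: "nat set \<Rightarrow> (nat \<Rightarrow> int) \<Rightarrow> nat \<Rightarrow> int" where
  "flip A x = (\<lambda>i. if i \<in> A then - x i else x i)"

lemma flip_flip [simp]: "flip A (flip A x) = x"
  by (auto simp: flip_def)

lemma flip_in_grid: "A \<subseteq> {..<k} \<Longrightarrow> x \<in> grid h k \<Longrightarrow> flip A x \<in> grid h k"
  unfolding grid_def flip_def by (auto simp: PiE_iff extensional_def; force)

lemma bij_betw_flip: "A \<subseteq> {..<k} \<Longrightarrow> bij_betw (flip A) (grid h k) (grid h k)"
  by (rule bij_betwI[where g = "flip A"]) (auto intro: flip_in_grid)

lemma symmetric_interval_transport:
  fixes u v :: "int \<Rightarrow> real"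
  assumes "\<And>s. s \<in> {- int h..int h} \<Longrightarrow> 0 \<le> u s" "\<And>s. s \<in> {- int h..int h} \<Longrightarrow> 0 \<le> v s"
    and "\<And>s t. s \<in> {- int h..int h} \<Longrightarrow> t \<in> {- int h..int h} \<Longrightarrow>
      u s * v t \<le> exp (slack_cost (2 * h + 1) (real_of_int (s - t)))"
  shows "(\<Sum>s\<in>{- int h..int h}. u s) * (\<Sum>s\<in>{- int h..int h}. v s) \<le> (real (2 * h + 1))\<^sup>2"
proof -
  define g where "g i = int i - int h" for i
  have bij: "bij_betw g {..<2 * h + 1} {- int h..int h}"
    by (rule bij_betwI[where g = "\<lambda>s. nat (s + int h)"]) (auto simp: g_def)
  have g: "g i \<in> {- int h..int h}" if "i < 2 * h + 1" for i using that by (auto simp: g_def)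
  have "(\<Sum>i<2*h+1. u (g i)) * (\<Sum>i<2*h+1. v (g i)) \<le> (real (2 * h + 1))\<^sup>2"
  proof (rule interval_transport)
    fix i j assume ij: "i < 2 * h + 1" "j < 2 * h + 1"
    have "real_of_int (g i - g j) = real i - real j" by (simp add: g_def)
    then show "u (g i) * v (g j) \<le> exp (slack_cost (real (2 * h + 1)) (real i - real j))"
      using assms(3)[OF g[OF ij(1)] g[OF ij(2)]] by simp
  qed (use assms(1,2) g in auto)
  then show ?thesis unfolding sum.reindex_bij_betw[OF bij] .
qed

lemma grid_transport:
  fixes u v :: "(nat \<Rightarrow> int) \<Rightarrow> real"
  assumes "\<And>x. x \<in> grid h k \<Longrightarrow> 0 \<le> u x" "\<And>x. x \<in> grid h k \<Longrightarrow> 0 \<le> v x"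
    and "\<And>x y. x \<in> grid h k \<Longrightarrow> y \<in> grid h k \<Longrightarrow>
      u x * v y \<le> exp (\<Sum>i<k. slack_cost (2 * h + 1) (real_of_int (x i - y i)))"
  shows "(\<Sum>x\<in>grid h k. u x) * (\<Sum>x\<in>grid h k. v x) \<le> (real (card (grid h k)))\<^sup>2"
proof -
  have "(\<Sum>x\<in>grid h k. u x) * (\<Sum>x\<in>grid h k. v x) \<le> (real (2 * h + 1) ^ card {..<k})\<^sup>2"
    unfolding grid_def
    by (rule transport_tensor[where w = "\<lambda>s t. slack_cost (2 * h + 1) (real_of_int (s - t))"])
       (use assms symmetric_interval_transport[of h] in \<open>auto simp: grid_def\<close>)
  then show ?thesis by (simp add: card_grid)
qed

text \<open>Transport between the indicator of \<open>A\<close> and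
  \<open>(1 / \<delta>)\<^sup>2\<close> times the indicator of its negative: if all pairs had cost
  at least \<open>2 * ln (1 / \<delta>)\<close>, then \<open>card A / \<delta>\<close> would be at
  most the size of the grid. The term \<open>2 * real k\<close> pays for the slack, 2 per
  coordinate.\<close>

lemma dense_set_has_almost_antipodal_pair:
  assumes A: "A \<subseteq> grid h k" and \<delta>: "\<delta> > 0" and card: "real (card A) > \<delta> * real (card (grid h k))"
  shows "\<exists>x\<in>A. \<exists>y\<in>A. (\<Sum>i<k. (real_of_int (x i + y i))\<^sup>2)
           < 32 * (real (2 * h + 1))\<^sup>2 * ln (1 / \<delta>) + 2 * real k"
proof -
  define L where "L = real (2 * h + 1)"
  have L: "L > 0" by (simp add: L_def)
  define B where "B = flip {..<k} ` A"
  have inj: "inj_on (flip {..<k}) A"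
    using bij_betw_flip[of "{..<k}" k h] A by (auto simp: bij_betw_def intro: inj_on_subset)
  have B: "B \<subseteq> grid h k" "card B = card A"
    using A flip_in_grid[of "{..<k}" k _ h] by (auto simp: B_def card_image[OF inj])
  have finA: "finite A" using A by (rule finite_subset) simp
  have "\<exists>x\<in>A. \<exists>y\<in>A. (\<Sum>i<k. slack_cost L (real_of_int (x i + y i))) < 2 * ln (1 / \<delta>)"
  proof (rule ccontr)
    assume "\<not> ?thesis"
    then have far: "2 * ln (1 / \<delta>) \<le> (\<Sum>i<k. slack_cost L (real_of_int (x i + y i)))"
      if "x \<in> A" "y \<in> A" for x y using that by force
    have "(\<Sum>x\<in>grid h k. if x \<in> A then 1 else 0) *
        (\<Sum>x\<in>grid h k. if x \<in> B then (1 / \<delta>)\<^sup>2 else 0) \<le> (real (card (grid h k)))\<^sup>2"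
    proof (rule grid_transport)
      fix x y
      have "(1 / \<delta>)\<^sup>2 \<le> exp (\<Sum>i<k. slack_cost L (real_of_int (x i - y i)))" if x: "x \<in> A" and y: "y \<in> B"
      proof -
        obtain z where z: "z \<in> A" "y = flip {..<k} z" using y unfolding B_def by blast
        have "(\<Sum>i<k. slack_cost L (real_of_int (x i - y i))) = (\<Sum>i<k. slack_cost L (real_of_int (x i + z i)))"
          unfolding z by (rule sum.cong) (auto simp: flip_def)
        then have "2 * ln (1 / \<delta>) \<le> (\<Sum>i<k. slack_cost L (real_of_int (x i - y i)))"
          using far[OF x z(1)] by simp
        moreover have "(1 / \<delta>)\<^sup>2 = exp (2 * ln (1 / \<delta>))"
          using \<delta> by (simp add: exp_double)
        ultimately show ?thesis by (simp only: exp_le_cancel_iff)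
      qed
      then show "(if x \<in> A then 1 else 0) * (if y \<in> B then (1 / \<delta>)\<^sup>2 else 0)
          \<le> exp (\<Sum>i<k. slack_cost (2 * h + 1) (real_of_int (x i - y i)))"
        by (auto simp: L_def)
    qed auto
    moreover have "(\<Sum>x\<in>grid h k. if x \<in> A then 1 else (0::real)) = real (card A)"
      using A by (simp add: sum.If_cases Int_absorb1)
    moreover have "(\<Sum>x\<in>grid h k. if x \<in> B then (1 / \<delta>)\<^sup>2 else (0::real)) = real (card A) * (1 / \<delta>)\<^sup>2"
      using B by (simp add: sum.If_cases Int_absorb1)
    ultimately have "(real (card A) / \<delta>)\<^sup>2 \<le> (real (card (grid h k)))\<^sup>2"
      by (simp add: power2_eq_square)
    then have "real (card A) / \<delta> \<le> real (card (grid h k))"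
      by (rule power2_le_imp_le) simp
    then show False using card \<delta> by (simp add: field_simps)
  qed
  then obtain x y where xy: "x \<in> A" "y \<in> A"
    and lt: "(\<Sum>i<k. slack_cost L (real_of_int (x i + y i))) < 2 * ln (1 / \<delta>)" by blast
  \<comment> \<open>From \<open>(p + 1)\<^sup>2 \<le> 2 * p\<^sup>2 + 2\<close> with
    \<open>p = max 0 (\<bar>d\<bar> - 1)\<close>; the 16 is twice the 8 of
    \<open>slack_cost\<close>.\<close>
  have "(real_of_int (x i + y i))\<^sup>2 \<le> 16 * L\<^sup>2 * slack_cost L (real_of_int (x i + y i)) + 2" for i
  proof -
    define d where "d = real_of_int (x i + y i)"
    have "d\<^sup>2 \<le> 2 * (max 0 (\<bar>d\<bar> - 1))\<^sup>2 + 2"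
    proof -
      have "\<bar>d\<bar> \<le> max 0 (\<bar>d\<bar> - 1) + 1" by auto
      then have "\<bar>d\<bar>\<^sup>2 \<le> (max 0 (\<bar>d\<bar> - 1) + 1)\<^sup>2" by (intro power_mono) auto
      also have "\<dots> \<le> 2 * (max 0 (\<bar>d\<bar> - 1))\<^sup>2 + 2"
        using zero_le_power2[of "max 0 (\<bar>d\<bar> - 1) - 1"] by (simp add: power2_eq_square algebra_simps)
      finally show ?thesis by simp
    qed
    then show ?thesis using L by (simp add: slack_cost_def d_def)
  qed
  then have "(\<Sum>i<k. (real_of_int (x i + y i))\<^sup>2)
      \<le> (\<Sum>i<k. 16 * L\<^sup>2 * slack_cost L (real_of_int (x i + y i)) + 2)"
    by (intro sum_mono)
  also have "\<dots> = 16 * L\<^sup>2 * (\<Sum>i<k. slack_cost L (real_of_int (x i + y i))) + 2 * real k"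
    by (simp add: sum.distrib flip: sum_distrib_left)
  also have "\<dots> < 16 * L\<^sup>2 * (2 * ln (1 / \<delta>)) + 2 * real k"
    using lt L by simp
  also have "\<dots> = 32 * L\<^sup>2 * ln (1 / \<delta>) + 2 * real k" by simp
  finally show ?thesis using xy unfolding L_def by blast
qed

section \<open>Subset sums\<close>

text \<open>The left side is the probability that a random maximal chain of subsets of
  \<open>S\<close> passes through \<open>A\<close>; the right side conditions on the penultimate
  member \<open>S - {s}\<close> of the chain.\<close>

lemma inverse_binomial_average:
  assumes "finite S" "A \<subset> S"
  shows "1 / real (card S choose card A)
    = (\<Sum>s\<in>S - A. 1 / (real (card S) * real ((card S - 1) choose card A)))"
proof -
  define n a where "n = card S" and "a = card A"
  have "a < n" using assms by (simp add: n_def a_def psubset_card_mono)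
  have "card (S - A) = n - a"
    using assms by (auto simp: n_def a_def intro!: card_Diff_subset finite_subset[of A S])
  moreover have "n * ((n - 1) choose a) = (n - a) * (n choose a)"
    using binomial_absorb_comp[of n a] by simp
  then have "real n * real ((n - 1) choose a) = real (n - a) * real (n choose a)"
    by (metis of_nat_mult)
  ultimately show ?thesis using \<open>a < n\<close> by (simp add: n_def a_def)
qed

text \<open>
  A LYM inequality: along a maximal chain of subsets of \<open>S\<close> the sum grows by at least \<open>c\<close> in each
  step, so that at most \<open>r\<close> of its members have their sum in the given interval.
\<close>

lemma LYM_subset_sums:
  fixes b :: "'a \<Rightarrow> real"
  assumes "finite S" "\<And>i. i \<in> S \<Longrightarrow> c \<le> b i" "c > 0"
  shows "(\<Sum>A | A \<subseteq> S \<and> l \<le> sum b A \<and> sum b A < l + real r * c. 1 / real (card S choose card A)) \<le> real r"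
  using assms(1,2)
proof (induction "card S" arbitrary: S r)
  case 0
  have "r > 0" if "l \<le> 0" "0 < l + real r * c"
    using that by (cases r) auto
  moreover have "{A. A \<subseteq> S \<and> l \<le> sum b A \<and> sum b A < l + real r * c}
      = (if l \<le> 0 \<and> 0 < l + real r * c then {{}} else {})"
    using 0 by auto
  ultimately show ?case by (auto simp: Suc_le_eq)
next
  case (Suc n S r)
  define F where "F T r = {A. A \<subseteq> T \<and> l \<le> sum b A \<and> sum b A < l + real r * c}" for T and r :: nat
  have S: "finite S" "card S = Suc n" "S \<noteq> {}" using Suc by auto
  have finF: "finite (F T r)" if "finite T" for T r
    using that unfolding F_def by auto
  \<comment> \<open>Averages the induction hypothesis over the penultimate member
    \<open>S - {s}\<close>; \<open>q\<close> is the bound available for proper subsets, either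
    \<open>r\<close> or \<open>r - 1\<close>.\<close>
  have below: "(\<Sum>A\<in>F S r - {S}. 1 / real (card S choose card A)) \<le> real q"
    if q: "\<And>s. s \<in> S \<Longrightarrow> {A \<in> F S r - {S}. s \<notin> A} \<subseteq> F (S - {s}) q" for q
  proof -
    have "(\<Sum>A\<in>F S r - {S}. 1 / real (card S choose card A))
        = (\<Sum>A\<in>F S r - {S}. \<Sum>s | s \<in> S \<and> s \<notin> A. 1 / (real (card S) * real (n choose card A)))"
    proof (rule sum.cong)
      fix A assume "A \<in> F S r - {S}"
      then have "A \<subset> S" by (auto simp: F_def)
      moreover have "{s. s \<in> S \<and> s \<notin> A} = S - A" by auto
      ultimately show "1 / real (card S choose card A) = (\<Sum>s | s \<in> S \<and> s \<notin> A. 1 / (real (card S) * real (n choose card A)))"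
        using inverse_binomial_average[of S A] S by simp
    qed simp
    also have "\<dots> = (\<Sum>s\<in>S. \<Sum>A | A \<in> F S r - {S} \<and> s \<notin> A. 1 / (real (card S) * real (n choose card A)))"
      using S finF by (intro sum.swap_restrict) auto
    also have "\<dots> \<le> (\<Sum>s\<in>S. \<Sum>A\<in>F (S - {s}) q. 1 / (real (card S) * real (n choose card A)))"
      using q S finF by (intro sum_mono sum_mono2) auto
    also have "\<dots> = (\<Sum>s\<in>S. (\<Sum>A\<in>F (S - {s}) q. 1 / real (card (S - {s}) choose card A)) / real (card S))"
      using S by (intro sum.cong) (auto simp: sum_divide_distrib mult.commute)
    also have "\<dots> \<le> (\<Sum>s\<in>S. real q / real (card S))"
      unfolding F_def
      using S Suc.prems by (intro sum_mono divide_right_mono Suc.hyps) auto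
    also have "\<dots> = real q" using S by simp
    finally show ?thesis .
  qed
  show ?case
  proof (cases "S \<in> F S r")
    case False
    have "{A \<in> F S r - {S}. s \<notin> A} \<subseteq> F (S - {s}) r" for s by (auto simp: F_def)
    then have "(\<Sum>A\<in>F S r - {S}. 1 / real (card S choose card A)) \<le> real r" by (rule below)
    then show ?thesis using False by (simp add: F_def)
  next
    case True
    then have r: "r > 0" by (cases r) (auto simp: F_def)
    \<comment> \<open>\<open>S\<close> itself lies in the interval and \<open>b s \<ge> c\<close>,
      so the sets avoiding \<open>s\<close> have sums at least \<open>c\<close> smaller and fit into
      an interval one step shorter.\<close>
    have "{A \<in> F S r - {S}. s \<notin> A} \<subseteq> F (S - {s}) (r - 1)" if s: "s \<in> S" for s
    proof
      fix A assume A: "A \<in> {A \<in> F S r - {S}. s \<notin> A}"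
      have "c \<le> b s" using Suc.prems s by auto
      also have "\<dots> \<le> sum b (S - A)"
        using s A S Suc.prems(2) \<open>c > 0\<close>
        by (intro member_le_sum) (auto intro: order_trans[OF less_imp_le])
      also have "\<dots> = sum b S - sum b A" using A S by (intro sum_diff) (auto simp: F_def)
      finally have "sum b A < l + real (r - 1) * c"
        using True r by (auto simp: F_def of_nat_diff algebra_simps)
      then show "A \<in> F (S - {s}) (r - 1)" using A by (auto simp: F_def)
    qed
    then have "(\<Sum>A\<in>F S r - {S}. 1 / real (card S choose card A)) \<le> real (r - 1)" by (rule below)
    moreover have "(\<Sum>A\<in>F S r. 1 / real (card S choose card A))
        = 1 / real (card S choose card S) + (\<Sum>A\<in>F S r - {S}. 1 / real (card S choose card A))"
      by (rule sum.remove) (use True finF S in auto)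
    ultimately show ?thesis using r by (simp add: F_def of_nat_diff)
  qed
qed

text \<open>No binomial coefficient exceeds the middle one, so every set has at least the reciprocal
  of the middle one as its weight in the LYM sum.\<close>

lemma littlewood_offord_pos:
  fixes b :: "'a \<Rightarrow> real"
  assumes "finite S" "\<And>i. i \<in> S \<Longrightarrow> c \<le> b i" "c > 0"
  shows "card {A. A \<subseteq> S \<and> l \<le> sum b A \<and> sum b A < l + real r * c} \<le> r * (card S choose (card S div 2))"
proof -
  define F where "F = {A. A \<subseteq> S \<and> l \<le> sum b A \<and> sum b A < l + real r * c}"
  define m where "m = real (card S choose (card S div 2))"
  have m: "m > 0" by (simp add: m_def)
  have "real (card F) / m = (\<Sum>A\<in>F. 1 / m)" by simp
  also have "\<dots> \<le> (\<Sum>A\<in>F. 1 / real (card S choose card A))"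
  proof (rule sum_mono)
    fix A assume "A \<in> F"
    then have "card A \<le> card S" using assms(1) by (auto simp: F_def card_mono)
    then show "1 / m \<le> 1 / real (card S choose card A)"
      unfolding m_def using binomial_maximum[of "card S" "card A"]
      by (intro divide_left_mono) auto
  qed
  also have "\<dots> \<le> real r" unfolding F_def by (rule LYM_subset_sums) (use assms in auto)
  finally have "real (card F) \<le> real (r * (card S choose (card S div 2)))"
    using m by (simp add: m_def field_simps)
  then show ?thesis unfolding F_def of_nat_le_iff .
qed

text \<open>Symmetric difference with the set \<open>N\<close> of negative entries is an involution
  on the subsets of \<open>S\<close>; it turns \<open>sum b A\<close> into a sum of absolute values,
  up to the constant shift \<open>sum b N\<close>.\<close>

lemma littlewood_offord:
  fixes b :: "'a \<Rightarrow> real"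
  assumes "finite S" "\<And>i. i \<in> S \<Longrightarrow> c \<le> \<bar>b i\<bar>" "c > 0"
  shows "card {A. A \<subseteq> S \<and> l \<le> sum b A \<and> sum b A < l + real r * c} \<le> r * (card S choose (card S div 2))"
proof -
  define N where "N = {i \<in> S. b i < 0}"
  define \<phi> where "\<phi> A = (A - N) \<union> (N - A)" for A
  have \<phi>\<phi>: "\<phi> (\<phi> A) = A" for A by (auto simp: \<phi>_def)
  have sum_\<phi>: "sum (\<lambda>i. \<bar>b i\<bar>) (\<phi> A) = sum b A - sum b N" if "A \<subseteq> S" for A
  proof -
    have fin: "finite A" "finite N" using that assms(1) by (auto simp: N_def intro: finite_subset)
    have "sum (\<lambda>i. \<bar>b i\<bar>) (\<phi> A) = sum (\<lambda>i. \<bar>b i\<bar>) (A - N) + sum (\<lambda>i. \<bar>b i\<bar>) (N - A)"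
      unfolding \<phi>_def using fin by (intro sum.union_disjoint) auto
    also have "sum (\<lambda>i. \<bar>b i\<bar>) (A - N) = sum b (A - N)"
      using that by (intro sum.cong) (auto simp: N_def)
    also have "sum (\<lambda>i. \<bar>b i\<bar>) (N - A) = - sum b (N - A)"
      unfolding sum_negf[symmetric] by (intro sum.cong) (auto simp: N_def)
    also have "sum b (A - N) + - sum b (N - A) = sum b A - sum b N"
      using sum.Int_Diff[of A b N] sum.Int_Diff[of N b A] fin by (simp add: Int_commute)
    finally show ?thesis .
  qed
  have "card {A. A \<subseteq> S \<and> l \<le> sum b A \<and> sum b A < l + real r * c}
      \<le> card {A. A \<subseteq> S \<and> l - sum b N \<le> sum (\<lambda>i. \<bar>b i\<bar>) A \<and>
          sum (\<lambda>i. \<bar>b i\<bar>) A < (l - sum b N) + real r * c}"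
  proof (rule card_inj_on_le[where f = \<phi>])
    show "inj_on \<phi> {A. A \<subseteq> S \<and> l \<le> sum b A \<and> sum b A < l + real r * c}"
      by (rule inj_on_inverseI[where g = \<phi>]) (rule \<phi>\<phi>)
    have "\<phi> A \<subseteq> S" if "A \<subseteq> S" for A using that by (auto simp: \<phi>_def N_def)
    then show "\<phi> ` {A. A \<subseteq> S \<and> l \<le> sum b A \<and> sum b A < l + real r * c}
      \<subseteq> {A. A \<subseteq> S \<and> l - sum b N \<le> sum (\<lambda>i. \<bar>b i\<bar>) A \<and>
          sum (\<lambda>i. \<bar>b i\<bar>) A < (l - sum b N) + real r * c}"
      by (auto simp: sum_\<phi>)
    show "finite {A. A \<subseteq> S \<and> l - sum b N \<le> sum (\<lambda>i. \<bar>b i\<bar>) A \<and>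
          sum (\<lambda>i. \<bar>b i\<bar>) A < (l - sum b N) + real r * c}" using assms(1) by auto
  qed
  also have "\<dots> \<le> r * (card S choose (card S div 2))"
    by (rule littlewood_offord_pos) (use assms in auto)
  finally show ?thesis .
qed

text \<open>Each of the \<open>2 ^ card D\<close> choices of \<open>A \<inter> D\<close> merely
  shifts \<open>l\<close>, which leaves the Littlewood--Offord problem on \<open>M\<close>.\<close>

lemma littlewood_offord_subset:
  fixes b :: "'a \<Rightarrow> real"
  assumes "finite M" "\<And>i. i \<in> M \<Longrightarrow> c \<le> \<bar>b i\<bar>" "c > 0" "finite D" "D \<inter> M = {}"
  shows "card {A. A \<subseteq> D \<union> M \<and> l \<le> sum b A \<and> sum b A < l + real r * c}
    \<le> 2 ^ card D * (r * (card M choose (card M div 2)))"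
  using assms(4,5)
proof (induction D arbitrary: l rule: finite_induct)
  case empty
  then show ?case using littlewood_offord[OF assms(1-3)] by simp
next
  case (insert d D)
  define F where "F l = {A. A \<subseteq> D \<union> M \<and> l \<le> sum b A \<and> sum b A < l + real r * c}" for l
  have fin: "finite (F l)" for l using insert.hyps assms(1) by (simp add: F_def)
  have d: "d \<notin> D \<union> M" using insert by auto
  have "{A. A \<subseteq> insert d D \<union> M \<and> l \<le> sum b A \<and> sum b A < l + real r * c}
      \<subseteq> F l \<union> insert d ` F (l - b d)"
  proof
    fix A assume A: "A \<in> {A. A \<subseteq> insert d D \<union> M \<and> l \<le> sum b A \<and> sum b A < l + real r * c}"
    then have finA: "finite A" using insert.hyps assms(1) by (auto intro: finite_subset)
    show "A \<in> F l \<union> insert d ` F (l - b d)"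
    proof (cases "d \<in> A")
      case True
      then have "sum b A = b d + sum b (A - {d})" using finA by (simp add: sum.remove)
      then have "A - {d} \<in> F (l - b d)" using A by (auto simp: F_def)
      moreover have "A = insert d (A - {d})" using True by auto
      ultimately show ?thesis by blast
    next
      case False
      then show ?thesis using A by (auto simp: F_def)
    qed
  qed
  then have "card {A. A \<subseteq> insert d D \<union> M \<and> l \<le> sum b A \<and> sum b A < l + real r * c}
      \<le> card (F l \<union> insert d ` F (l - b d))"
    using fin by (intro card_mono) auto
  also have "\<dots> \<le> card (F l) + card (F (l - b d))"
    by (rule order_trans[OF card_Un_le]) (use card_image_le[OF fin] in auto)
  also have "\<dots> \<le> 2 ^ card (insert d D) * (r * (card M choose (card M div 2)))"
    using insert.IH[of l] insert.IH[of "l - b d"] insert.prems insert.hyps by (auto simp: F_def)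
  finally show ?case .
qed

section \<open>Middle binomial coefficients\<close>

lemma central_binomial_upper: "real ((2 * m) choose m) \<le> 4 ^ m / sqrt (real (2 * m + 1))"
proof -
  \<comment> \<open>The squared form suits induction: by the ratio of consecutive central
    coefficients the step reduces to
    \<open>4 * (2 * m + 1) * (2 * m + 3) \<le> 16 * (m + 1)\<^sup>2\<close>.\<close>
  have "(real ((2 * m) choose m))\<^sup>2 * real (2 * m + 1) \<le> 16 ^ m"
  proof (induction m)
    case 0
    then show ?case by simp
  next
    case (Suc m)
    have "Suc m * ((2 * Suc m) choose Suc m) = 2 * (2 * m + 1) * ((2 * m) choose m)"
    proof -
      have "Suc m * (Suc (Suc (2 * m)) choose Suc m) = Suc (Suc (2 * m)) * (Suc (2 * m) choose m)"
        by (rule Suc_times_binomial)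
      moreover have "Suc m * (Suc (2 * m) choose m) = Suc (2 * m) * ((2 * m) choose m)"
        using Suc_times_binomial[of m "2 * m"] binomial_symmetric[of m "Suc (2 * m)"] by simp
      moreover have "Suc (Suc (2 * m)) * (Suc (2 * m) choose m) = 2 * (Suc m * (Suc (2 * m) choose m))"
        by simp
      ultimately show ?thesis by simp
    qed
    then have e: "real (Suc m) * real ((2 * Suc m) choose Suc m) = 2 * (2 * real m + 1) * real ((2 * m) choose m)"
    proof -
      have "real (Suc m * ((2 * Suc m) choose Suc m)) = real (2 * (2 * m + 1) * ((2 * m) choose m))"
        using \<open>Suc m * _ = _\<close> by (simp only:)
      then show ?thesis by (simp only: of_nat_mult of_nat_add of_nat_numeral of_nat_1)
    qed
    have "(real (Suc m))\<^sup>2 * ((real ((2 * Suc m) choose Suc m))\<^sup>2 * real (2 * Suc m + 1))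
        = (2 * (2 * real m + 1) * real ((2 * m) choose m))\<^sup>2 * (2 * real m + 3)"
      unfolding e[symmetric] by (simp add: power2_eq_square algebra_simps)
    also have "\<dots> = 4 * (2 * real m + 1) * (2 * real m + 3) * ((real ((2 * m) choose m))\<^sup>2 * real (2 * m + 1))"
      by (simp add: power2_eq_square algebra_simps)
    also have "\<dots> \<le> 16 * (real (Suc m))\<^sup>2 * 16 ^ m"
      using Suc by (rule mult_mono[rotated]) (auto simp: power2_eq_square algebra_simps)
    finally have "(real (Suc m))\<^sup>2 * ((real ((2 * Suc m) choose Suc m))\<^sup>2 * real (2 * Suc m + 1))
        \<le> (real (Suc m))\<^sup>2 * 16 ^ Suc m" by (simp add: mult_ac)
    then show ?case by (rule mult_left_le_imp_le) simp
  qed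
  moreover have "(4 ^ m)\<^sup>2 = (16::real) ^ m" by (simp add: power2_eq_square flip: power_mult_distrib)
  ultimately have "(real ((2 * m) choose m) * sqrt (real (2 * m + 1)))\<^sup>2 \<le> (4 ^ m)\<^sup>2"
    by (simp add: power_mult_distrib)
  then have "real ((2 * m) choose m) * sqrt (real (2 * m + 1)) \<le> 4 ^ m"
    by (rule power2_le_imp_le) simp
  then show ?thesis by (simp add: field_simps)
qed

lemma middle_binomial_upper: "real (n choose (n div 2)) \<le> 2 ^ n / sqrt (real (n + 1))"
proof (cases "even n")
  case True
  then obtain m where "n = 2 * m" by (elim evenE)
  then show ?thesis using central_binomial_upper[of m] by (simp add: power_mult)
next
  case False
  then obtain m where n: "n = 2 * m + 1" by (elim oddE)
  \<comment> \<open>For odd \<open>n\<close> the middle coefficient is half of the next central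
    one.\<close>
  have "(2 * Suc m) choose Suc m = (Suc (2 * m) choose m) + (Suc (2 * m) choose Suc m)"
    by (simp add: binomial_Suc_Suc)
  moreover have "Suc (2 * m) choose Suc m = Suc (2 * m) choose m"
    using binomial_symmetric[of m "Suc (2 * m)"] by simp
  ultimately have "real ((2 * Suc m) choose Suc m) = 2 * real (n choose (n div 2))"
    using n by simp
  then have "2 * real (n choose (n div 2)) \<le> 4 ^ Suc m / sqrt (real (2 * Suc m + 1))"
    using central_binomial_upper[of "Suc m"] by simp
  also have "\<dots> \<le> 4 ^ Suc m / sqrt (real (n + 1))"
    unfolding n by (intro divide_left_mono) auto
  also have "\<dots> = 2 * (2 ^ n / sqrt (real (n + 1)))"
    unfolding n by (simp add: power_mult)
  finally show ?thesis by simp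
qed

section \<open>Almost antipodal points and large inner products\<close>

text \<open>At such a coordinate \<open>\<bar>x i * y i\<bar> \<ge> h\<^sup>2 / 4\<close>, so a sign
  flip there moves the inner product by at least \<open>h\<^sup>2 / 2\<close>. Only absolute values
  enter, so flips preserve the set.\<close>

definition wide :: "nat \<Rightarrow> nat \<Rightarrow> (nat \<Rightarrow> int) \<Rightarrow> (nat \<Rightarrow> int) \<Rightarrow> nat set" where
  "wide h k x y = {i. i < k \<and> int h \<le> 2 * \<bar>x i\<bar> \<and> int h \<le> 2 * \<bar>y i\<bar>}"

lemma finite_wide [simp]: "finite (wide h k x y)"
  by (simp add: wide_def)

lemma wide_flip [simp]: "wide h k (flip A x) y = wide h k x y"
  by (auto simp: wide_def flip_def)

text \<open>More than half of the \<open>2 * h + 1\<close> values qualify, so a coordinate of a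
  random pair is wide with probability above 1/4.\<close>

lemma card_wide_coordinates: "h + 1 \<le> card {s \<in> {- int h..int h}. int h \<le> 2 * \<bar>s\<bar>}"
proof -
  have "{s \<in> {- int h..int h}. \<not> int h \<le> 2 * \<bar>s\<bar>} \<subseteq> {- ((int h - 1) div 2)..(int h - 1) div 2}"
    by auto
  then have "card {s \<in> {- int h..int h}. \<not> int h \<le> 2 * \<bar>s\<bar>} \<le> card {- ((int h - 1) div 2)..(int h - 1) div 2}"
    by (rule card_mono[rotated]) simp
  also have "\<dots> \<le> h" by auto
  finally have "card {s \<in> {- int h..int h}. \<not> int h \<le> 2 * \<bar>s\<bar>} \<le> h" .
  moreover have "card {- int h..int h} = card {s \<in> {- int h..int h}. int h \<le> 2 * \<bar>s\<bar>}
      + card {s \<in> {- int h..int h}. \<not> int h \<le> 2 * \<bar>s\<bar>}" (is "_ = card ?A + card ?B")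
  proof -
    have fin: "finite ?A" "finite ?B"
      by (rule finite_subset[of _ "{- int h..int h}"], blast, simp)+
    have "card ?A + card ?B = card (?A \<union> ?B)"
      by (rule card_Un_disjoint[symmetric, OF fin]) blast
    also have "?A \<union> ?B = {- int h..int h}" by blast
    finally show ?thesis by (rule sym)
  qed
  ultimately show ?thesis by simp
qed

text \<open>The coordinates of a uniform pair are independent, so the generating function of the
  number of wide ones is a \<open>k\<close>-th power.\<close>

lemma sum_power_card_wide:
  fixes z :: real
  shows "(\<Sum>x\<in>grid h k. \<Sum>y\<in>grid h k. z ^ card (wide h k x y))
    = (\<Sum>s\<in>{- int h..int h}. \<Sum>t\<in>{- int h..int h}. if int h \<le> 2 * \<bar>s\<bar> \<and> int h \<le> 2 * \<bar>t\<bar> then z else 1) ^ k"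
proof -
  define w where "w s t = (if int h \<le> 2 * \<bar>s\<bar> \<and> int h \<le> 2 * \<bar>t\<bar> then z else 1)" for s t
  have "z ^ card (wide h k x y) = (\<Prod>i<k. w (x i) (y i))" for x y
  proof -
    have "wide h k x y = {..<k} \<inter> {i. int h \<le> 2 * \<bar>x i\<bar> \<and> int h \<le> 2 * \<bar>y i\<bar>}"
      by (auto simp: wide_def)
    then show ?thesis by (simp add: w_def prod.If_cases)
  qed
  then have "(\<Sum>x\<in>grid h k. \<Sum>y\<in>grid h k. z ^ card (wide h k x y))
      = (\<Sum>x\<in>grid h k. \<Sum>y\<in>grid h k. \<Prod>i<k. w (x i) (y i))" by simp
  also have "\<dots> = (\<Sum>x\<in>grid h k. \<Prod>i<k. \<Sum>t\<in>{- int h..int h}. w (x i) t)"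
    unfolding grid_def by (subst prod_sum_PiE) auto
  also have "\<dots> = (\<Prod>i<k. \<Sum>s\<in>{- int h..int h}. \<Sum>t\<in>{- int h..int h}. w s t)"
    unfolding grid_def by (subst prod_sum_PiE) auto
  finally show ?thesis by (simp add: w_def)
qed

text \<open>Exponential moments: on average more than a quarter of the coordinates are wide, so
  fewer than an eighth is a large deviation.\<close>

lemma few_pairs_with_few_wide_coordinates:
  "real (card {(x, y) \<in> grid h k \<times> grid h k. 8 * card (wide h k x y) < k})
    \<le> (24 / 25) ^ k * (real (card (grid h k)))\<^sup>2"
proof -
  define S where "S = {- int h..int h}"
  define W where "W = {s \<in> S. int h \<le> 2 * \<bar>s\<bar>}"
  define L where "L = real (2 * h + 1)"
  \<comment> \<open>For the exceptional pairs this makes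
    \<open>z ^ card (wide h k x y) \<ge> (9 / 10) ^ k\<close>, while the mean of one factor is at
    most \<open>1 - (1 - z) / 4 \<le> 86 / 100\<close>; the quotient of 86/100 and 9/10 is below
    24/25.\<close>
  define z where "z = (9 / 10 :: real) ^ 8"
  define N where "N = {(x, y) \<in> grid h k \<times> grid h k. 8 * card (wide h k x y) < k}"
  have z: "0 \<le> z" "z \<le> 44 / 100" by (auto simp: z_def power_divide)
  have S: "finite S" "real (card S) = L" by (auto simp: S_def L_def)
  have W: "W \<subseteq> S" by (auto simp: W_def)
  then have W: "L / 2 \<le> real (card W)" "finite W" "W \<subseteq> S"
    using card_wide_coordinates[of h] S(1) unfolding W_def[unfolded S_def, symmetric]
    by (auto simp: L_def intro: finite_subset)
  have "(\<Sum>s\<in>S. \<Sum>t\<in>S. if int h \<le> 2 * \<bar>s\<bar> \<and> int h \<le> 2 * \<bar>t\<bar> then z else 1)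
      = (\<Sum>p\<in>S \<times> S. 1 - (1 - z) * (if p \<in> W \<times> W then 1 else 0))"
    unfolding sum.cartesian_product by (rule sum.cong) (auto simp: W_def split: if_splits)
  also have "\<dots> = L\<^sup>2 - (1 - z) * (real (card W))\<^sup>2"
  proof -
    have "(S \<times> S) \<inter> (W \<times> W) = W \<times> W" using W by auto
    then show ?thesis using S W
      by (simp add: sum_subtractf sum.If_cases card_cartesian_product power2_eq_square flip: sum_distrib_left)
  qed
  also have "\<dots> \<le> L\<^sup>2 - (1 - z) * (L / 2)\<^sup>2"
    using W z by (intro diff_left_mono mult_left_mono power_mono) (auto simp: L_def)
  also have "\<dots> = (1 - (1 - z) / 4) * L\<^sup>2" by (simp add: power2_eq_square field_simps)
  also have "\<dots> \<le> 86 / 100 * L\<^sup>2" using z by (intro mult_right_mono) auto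
  finally have base: "(\<Sum>s\<in>S. \<Sum>t\<in>S. if int h \<le> 2 * \<bar>s\<bar> \<and> int h \<le> 2 * \<bar>t\<bar> then z else 1) \<le> 86 / 100 * L\<^sup>2" .
  have "real (card N) * (9 / 10) ^ k = (\<Sum>p\<in>N. (9 / 10) ^ k)" by simp
  also have "\<dots> \<le> (\<Sum>(x, y)\<in>N. z ^ card (wide h k x y))"
  proof (rule sum_mono)
    fix p assume "p \<in> N"
    then have "8 * card (wide h k (fst p) (snd p)) \<le> k" by (auto simp: N_def)
    then have "(9 / 10) ^ k \<le> (9 / 10 :: real) ^ (8 * card (wide h k (fst p) (snd p)))"
      by (intro power_decreasing) auto
    then show "(9 / 10) ^ k \<le> (case p of (x, y) \<Rightarrow> z ^ card (wide h k x y))"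
      by (simp add: z_def power_mult case_prod_unfold)
  qed
  also have "\<dots> \<le> (\<Sum>(x, y)\<in>grid h k \<times> grid h k. z ^ card (wide h k x y))"
    using z by (intro sum_mono2) (auto simp: N_def)
  also have "\<dots> = (\<Sum>s\<in>S. \<Sum>t\<in>S. if int h \<le> 2 * \<bar>s\<bar> \<and> int h \<le> 2 * \<bar>t\<bar> then z else 1) ^ k"
    unfolding S_def sum_power_card_wide[symmetric] by (simp add: sum.cartesian_product)
  also have "\<dots> \<le> (86 / 100 * L\<^sup>2) ^ k"
    using base z by (intro power_mono sum_nonneg) auto
  also have "\<dots> = (86 / 100) ^ k * (real (card (grid h k)))\<^sup>2"
    unfolding power_mult_distrib card_grid L_def by (simp add: mult.commute flip: power_mult)
  finally have "real (card N) * (9 / 10) ^ k \<le> (86 / 100) ^ k * (real (card (grid h k)))\<^sup>2" .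
  then have "real (card N) \<le> (86 / 100) ^ k / (9 / 10) ^ k * (real (card (grid h k)))\<^sup>2"
    by (simp add: field_simps)
  also have "\<dots> \<le> (24 / 25) ^ k * (real (card (grid h k)))\<^sup>2"
    by (intro mult_right_mono) (auto simp flip: power_divide intro!: power_mono)
  finally show ?thesis by (simp add: N_def)
qed

text \<open>A point with few wide coordinates against itself has few against every \<open>y\<close>,
  so it spoils a whole row of pairs.\<close>

lemma few_points_with_few_wide_coordinates:
  "real (card {x \<in> grid h k. 8 * card (wide h k x x) < k}) \<le> (24 / 25) ^ k * real (card (grid h k))"
proof -
  define g where "g = real (card (grid h k))"
  have g: "g > 0" by (simp add: g_def card_grid)
  define N where "N = {x \<in> grid h k. 8 * card (wide h k x x) < k}"
  have "8 * card (wide h k x y) < k" if "8 * card (wide h k x x) < k" for x y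
  proof -
    have "card (wide h k x y) \<le> card (wide h k x x)"
      by (intro card_mono) (auto simp: wide_def)
    then show ?thesis using that by simp
  qed
  then have "N \<times> grid h k \<subseteq> {(x, y) \<in> grid h k \<times> grid h k. 8 * card (wide h k x y) < k}"
    unfolding N_def by blast
  then have "card (N \<times> grid h k) \<le> card {(x, y) \<in> grid h k \<times> grid h k. 8 * card (wide h k x y) < k}"
    by (rule card_mono[rotated]) (auto intro: finite_subset[of _ "grid h k \<times> grid h k"])
  then have "real (card N) * g \<le> (24 / 25) ^ k * g\<^sup>2"
    using few_pairs_with_few_wide_coordinates[of h k]
    unfolding card_cartesian_product g_def by (simp flip: of_nat_mult)
  then show ?thesis using g by (simp add: N_def g_def power2_eq_square)
qed

section \<open>Anticoncentration of inner products\<close>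

definition dot :: "nat \<Rightarrow> (nat \<Rightarrow> int) \<Rightarrow> (nat \<Rightarrow> int) \<Rightarrow> real" where
  "dot k x y = (\<Sum>i<k. real_of_int (x i) * real_of_int (y i))"

lemma dot_flip:
  assumes "A \<subseteq> {..<k}"
  shows "dot k (flip A x) y = dot k x y - 2 * (\<Sum>i\<in>A. real_of_int (x i) * real_of_int (y i))"
proof -
  have "dot k (flip A x) y = (\<Sum>i<k. real_of_int (x i) * real_of_int (y i)
      - 2 * (if i \<in> A then real_of_int (x i) * real_of_int (y i) else 0))"
    unfolding dot_def by (rule sum.cong) (auto simp: flip_def)
  also have "\<dots> = dot k x y - 2 * (\<Sum>i<k. if i \<in> A then real_of_int (x i) * real_of_int (y i) else 0)"
    by (simp add: dot_def sum_subtractf sum_distrib_left)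
  also have "(\<Sum>i<k. if i \<in> A then real_of_int (x i) * real_of_int (y i) else 0)
      = (\<Sum>i\<in>A. real_of_int (x i) * real_of_int (y i))"
    using assms by (simp add: sum.If_cases Int_absorb1)
  finally show ?thesis .
qed

text \<open>By \<open>dot_flip\<close>, a small inner product confines the sum of
  \<open>x i * y i\<close> over \<open>A\<close> to an interval of length \<open>R / 4\<close>,
  which is at most \<open>r\<close> steps of \<open>h\<^sup>2 / 4\<close>. Littlewood--Offord then
  applies to the wide coordinates, at least \<open>k / 8\<close> in number.\<close>

lemma few_flips_with_small_dot:
  assumes h: "h > 0" and k: "k > 0" and R: "R \<le> real r * (real h)\<^sup>2" and wide: "k \<le> 8 * card (wide h k x y)"
  shows "real (card {A. A \<subseteq> {..<k} \<and> \<bar>4 * dot k (flip A x) y\<bar> < R})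
    \<le> 2 ^ k * (real r / sqrt (real k / 8))"
proof -
  define M where "M = wide h k x y"
  define b where "b i = real_of_int (x i) * real_of_int (y i)" for i
  define l where "l = dot k x y / 2 - R / 8"
  define D where "D = {..<k} - M"
  have M: "M \<subseteq> {..<k}" "finite M" by (auto simp: M_def wide_def)
  have D: "finite D" "D \<inter> M = {}" "D \<union> M = {..<k}" using M by (auto simp: D_def)
  have cD: "card D + card M = k" using card_Un_disjoint[of D M] D M by simp
  have bM: "(real h)\<^sup>2 / 4 \<le> \<bar>b i\<bar>" if "i \<in> M" for i
  proof -
    have "real h / 2 \<le> \<bar>real_of_int (x i)\<bar>" "real h / 2 \<le> \<bar>real_of_int (y i)\<bar>"
      using that by (auto simp: M_def wide_def)
    then have "real h / 2 * (real h / 2) \<le> \<bar>real_of_int (x i)\<bar> * \<bar>real_of_int (y i)\<bar>"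
      by (intro mult_mono) auto
    then show ?thesis by (simp add: b_def abs_mult power2_eq_square)
  qed
  have "{A. A \<subseteq> {..<k} \<and> \<bar>4 * dot k (flip A x) y\<bar> < R}
      \<subseteq> {A. A \<subseteq> D \<union> M \<and> l \<le> sum b A \<and> sum b A < l + real r * ((real h)\<^sup>2 / 4)}"
  proof safe
    fix A i assume A: "A \<subseteq> {..<k}" and lt: "\<bar>4 * dot k (flip A x) y\<bar> < R"
    have e: "dot k (flip A x) y = dot k x y - 2 * sum b A"
      unfolding b_def by (rule dot_flip[OF A])
    show "l \<le> sum b A" "sum b A < l + real r * ((real h)\<^sup>2 / 4)"
      using lt R unfolding e l_def by (simp_all add: abs_less_iff)
  qed (use D in auto)
  then have "card {A. A \<subseteq> {..<k} \<and> \<bar>4 * dot k (flip A x) y\<bar> < R}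
      \<le> card {A. A \<subseteq> D \<union> M \<and> l \<le> sum b A \<and> sum b A < l + real r * ((real h)\<^sup>2 / 4)}"
    by (rule card_mono[rotated]) (use D M in auto)
  also have "\<dots> \<le> 2 ^ card D * (r * (card M choose (card M div 2)))"
    by (rule littlewood_offord_subset) (use M D bM h in auto)
  finally have "real (card {A. A \<subseteq> {..<k} \<and> \<bar>4 * dot k (flip A x) y\<bar> < R})
      \<le> real (2 ^ card D * (r * (card M choose (card M div 2))))" by (simp only: of_nat_le_iff)
  also have "\<dots> = 2 ^ card D * (real r * real (card M choose (card M div 2)))" by simp
  also have "\<dots> \<le> 2 ^ card D * (real r * (2 ^ card M / sqrt (real (card M + 1))))"
    by (intro mult_left_mono middle_binomial_upper) auto
  also have "\<dots> = 2 ^ k * (real r / sqrt (real (card M + 1)))"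
    using cD by (auto simp flip: power_add simp: mult_ac)
  also have "\<dots> \<le> 2 ^ k * (real r / sqrt (real k / 8))"
  proof -
    have "sqrt (real k / 8) \<le> sqrt (real (card M + 1))" "0 < sqrt (real k / 8)"
      using wide k by (auto simp: M_def)
    then show ?thesis by (intro mult_left_mono divide_left_mono) auto
  qed
  finally show ?thesis .
qed

text \<open>Every flip permutes the pairs with many wide coordinates, so the count equals its
  average over all \<open>2 ^ k\<close> flips; exchanging the sums reduces it to the bound for a
  fixed pair.\<close>

lemma few_pairs_with_small_dot:
  assumes h: "h > 0" and k: "k > 0" and R: "R \<le> real r * (real h)\<^sup>2"
  shows "real (card {(x, y) \<in> grid h k \<times> grid h k. k \<le> 8 * card (wide h k x y) \<and> \<bar>4 * dot k x y\<bar> < R})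
    \<le> real r / sqrt (real k / 8) * (real (card (grid h k)))\<^sup>2"
proof -
  define Q where "Q = {(x, y) \<in> grid h k \<times> grid h k. k \<le> 8 * card (wide h k x y)}"
  define P where "P A = {p \<in> Q. \<bar>4 * dot k (flip A (fst p)) (snd p)\<bar> < R}" for A
  define q where "q = real r / sqrt (real k / 8)"
  have q: "0 \<le> q" by (simp add: q_def)
  have Q: "Q \<subseteq> grid h k \<times> grid h k" by (auto simp: Q_def)
  have fin: "finite Q" by (rule finite_subset[OF Q]) simp
  have cardP: "card (P A) = card (P {})" if A: "A \<subseteq> {..<k}" for A
  proof -
    have "bij_betw (map_prod (flip A) id) (P A) (P {})"
    proof (rule bij_betwI[where g = "map_prod (flip A) id"])
      show "map_prod (flip A) id \<in> P A \<rightarrow> P {}" "map_prod (flip A) id \<in> P {} \<rightarrow> P A"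
        using flip_in_grid[OF A] by (auto simp: P_def Q_def) (auto simp: flip_def)
    qed auto
    then show ?thesis by (rule bij_betw_same_card)
  qed
  have "2 ^ k * card (P {}) = (\<Sum>A\<in>Pow {..<k}. card (P A))"
  proof -
    have "(\<Sum>A\<in>Pow {..<k}. card (P A)) = (\<Sum>A\<in>Pow {..<k}. card (P {}))"
      by (rule sum.cong[OF refl], rule cardP) simp
    then show ?thesis by (simp add: card_Pow)
  qed
  also have "\<dots> = (\<Sum>A\<in>Pow {..<k}. \<Sum>p | p \<in> Q \<and> \<bar>4 * dot k (flip A (fst p)) (snd p)\<bar> < R. 1)"
    by (simp add: P_def)
  also have "\<dots> = (\<Sum>p\<in>Q. \<Sum>A | A \<in> Pow {..<k} \<and> \<bar>4 * dot k (flip A (fst p)) (snd p)\<bar> < R. 1)"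
    by (rule sum.swap_restrict) (use fin in auto)
  also have "\<dots> = (\<Sum>p\<in>Q. card {A. A \<subseteq> {..<k} \<and> \<bar>4 * dot k (flip A (fst p)) (snd p)\<bar> < R})"
    by simp
  finally have "real (2 ^ k * card (P {}))
      = real (\<Sum>p\<in>Q. card {A. A \<subseteq> {..<k} \<and> \<bar>4 * dot k (flip A (fst p)) (snd p)\<bar> < R})"
    by (rule arg_cong)
  then have "2 ^ k * real (card (P {}))
      = (\<Sum>p\<in>Q. real (card {A. A \<subseteq> {..<k} \<and> \<bar>4 * dot k (flip A (fst p)) (snd p)\<bar> < R}))"
    by simp
  also have "\<dots> \<le> (\<Sum>p\<in>Q. 2 ^ k * q)"
    unfolding q_def by (intro sum_mono few_flips_with_small_dot) (use h k R in \<open>auto simp: Q_def\<close>)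
  also have "\<dots> = 2 ^ k * (real (card Q) * q)" by simp
  finally have "real (card (P {})) \<le> real (card Q) * q" by simp
  also have "\<dots> \<le> (real (card (grid h k)))\<^sup>2 * q"
  proof -
    have "card Q \<le> card (grid h k) * card (grid h k)"
      using card_mono[OF _ Q] by (simp add: card_cartesian_product)
    then have "real (card Q) \<le> (real (card (grid h k)))\<^sup>2"
      unfolding power2_eq_square of_nat_mult[symmetric] of_nat_le_iff .
    then show ?thesis by (rule mult_right_mono) (rule q)
  qed
  also have "P {} = {(x, y) \<in> grid h k \<times> grid h k. k \<le> 8 * card (wide h k x y) \<and> \<bar>4 * dot k x y\<bar> < R}"
    by (auto simp: P_def Q_def flip_def)
  finally show ?thesis by (simp add: q_def mult.commute)
qed

text \<open>Negating \<open>x\<close> exchanges the inner products at least \<open>R / 4\<close>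
  with those at most \<open>- R / 4\<close>, so apart from the exceptional pairs bounded above each
  class receives half.\<close>

lemma many_pairs_with_large_dot:
  assumes h: "h > 0" and k: "k > 0" and R: "0 < R" "R \<le> real r * (real h)\<^sup>2"
  shows "(1 / 2 - (real r / sqrt (real k / 8) + (24 / 25) ^ k) / 2) * (real (card (grid h k)))\<^sup>2
    \<le> real (card {(x, y) \<in> grid h k \<times> grid h k. R \<le> 4 * dot k x y})"
proof -
  define G2 where "G2 = grid h k \<times> grid h k"
  define E where "E = {(x, y) \<in> G2. R \<le> 4 * dot k x y}"
  define E' where "E' = {(x, y) \<in> G2. 4 * dot k x y \<le> - R}"
  define B where "B = {(x, y) \<in> G2. 8 * card (wide h k x y) < k}"
  define C where "C = {(x, y) \<in> G2. k \<le> 8 * card (wide h k x y) \<and> \<bar>4 * dot k x y\<bar> < R}"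
  have fin: "finite G2" by (simp add: G2_def)
  have fins: "finite E" "finite E'" "finite B" "finite C"
    by (auto simp: E_def E'_def B_def C_def intro: finite_subset[OF _ fin])
  have dot_neg: "dot k (flip {..<k} x) y = - dot k x y" for x y
    unfolding dot_def sum_negf[symmetric] by (rule sum.cong) (auto simp: flip_def)
  have "bij_betw (map_prod (flip {..<k}) id) E E'"
  proof (rule bij_betwI[where g = "map_prod (flip {..<k}) id"])
    show "map_prod (flip {..<k}) id \<in> E \<rightarrow> E'" "map_prod (flip {..<k}) id \<in> E' \<rightarrow> E"
      using flip_in_grid[of "{..<k}" k] by (auto simp: E_def E'_def G2_def dot_neg)
  qed auto
  then have EE: "card E' = card E" by (simp add: bij_betw_same_card)
  have "G2 \<subseteq> E \<union> E' \<union> (B \<union> C)"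
    by (auto simp: E_def E'_def B_def C_def abs_less_iff not_less not_le)
  then have "card G2 \<le> card (E \<union> E' \<union> (B \<union> C))"
    using fins by (intro card_mono) auto
  also have "\<dots> \<le> (card E + card E') + (card B + card C)"
    by (intro order_trans[OF card_Un_le] add_mono card_Un_le)
  finally have "real (card G2) \<le> 2 * real (card E) + (real (card B) + real (card C))"
    unfolding EE by linarith
  moreover have "real (card G2) = (real (card (grid h k)))\<^sup>2"
    by (simp add: G2_def card_cartesian_product power2_eq_square)
  moreover have "real (card B) \<le> (24 / 25) ^ k * (real (card (grid h k)))\<^sup>2"
    unfolding B_def G2_def by (rule few_pairs_with_few_wide_coordinates)
  moreover have "real (card C) \<le> real r / sqrt (real k / 8) * (real (card (grid h k)))\<^sup>2"
    unfolding C_def G2_def by (rule few_pairs_with_small_dot) (use assms in auto)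
  moreover have "((real (card (grid h k)))\<^sup>2 - ((24 / 25) ^ k * (real (card (grid h k)))\<^sup>2
      + real r / sqrt (real k / 8) * (real (card (grid h k)))\<^sup>2)) / 2 \<le> real (card E)"
  proof -
    have "(g - (b + c)) / 2 \<le> e" if "g' \<le> 2 * e + (b' + c')" "g' = g" "b' \<le> b" "c' \<le> c"
      for g g' b b' c c' e :: real using that by auto
    then show ?thesis using calculation by blast
  qed
  moreover have "(g - (b * g + a * g)) / 2 = (1 / 2 - (a + b) / 2) * g" for a b g :: real
    by (simp add: field_simps)
  ultimately have "(1 / 2 - (real r / sqrt (real k / 8) + (24 / 25) ^ k) / 2) * (real (card (grid h k)))\<^sup>2
      \<le> real (card E)"
    by (simp only:)
  then show ?thesis by (simp add: E_def G2_def)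
qed

section \<open>The almost antipodal relation\<close>

definition near :: "nat \<Rightarrow> real \<Rightarrow> (nat \<Rightarrow> int) \<Rightarrow> (nat \<Rightarrow> int) \<Rightarrow> bool" where
  "near k R x y \<longleftrightarrow> 9 * R \<le> 4 * dot k x x \<and> 9 * R \<le> 4 * dot k y y \<and>
     (\<Sum>i<k. (real_of_int (x i + y i))\<^sup>2) < R"

lemma near_sym: "near k R x y \<Longrightarrow> near k R y x"
  by (auto simp: near_def add.commute)

text \<open>From \<open>2 * x = (x + y) + (x + z) - (y + z)\<close> and Cauchy--Schwarz,
  \<open>4 * dot k x x\<close> would be less than \<open>3 * (3 * R)\<close>, which explains the 9
  in \<open>near\<close>. The case of equal points shows that \<open>near\<close> is
  irreflexive.\<close>

lemma near_triangle_free: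
  assumes "near k R x y" "near k R x z" "near k R y z"
  shows False
proof -
  have "4 * dot k x x = (\<Sum>i<k. (2 * real_of_int (x i))\<^sup>2)"
    by (simp add: dot_def sum_distrib_left power2_eq_square)
  also have "\<dots> \<le> (\<Sum>i<k. 3 * ((real_of_int (x i + y i))\<^sup>2 + (real_of_int (x i + z i))\<^sup>2
      + (real_of_int (y i + z i))\<^sup>2))"
  proof (rule sum_mono)
    fix i
    have "(a + b - c)\<^sup>2 \<le> 3 * (a\<^sup>2 + b\<^sup>2 + c\<^sup>2)" for a b c :: real
      using zero_le_power2[of "a - b"] zero_le_power2[of "a + c"] zero_le_power2[of "b + c"]
      by (simp add: power2_eq_square algebra_simps)
    from this[of "real_of_int (x i + y i)" "real_of_int (x i + z i)" "real_of_int (y i + z i)"]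
    show "(2 * real_of_int (x i))\<^sup>2 \<le> 3 * ((real_of_int (x i + y i))\<^sup>2 + (real_of_int (x i + z i))\<^sup>2
      + (real_of_int (y i + z i))\<^sup>2)" by simp
  qed
  also have "\<dots> = 3 * ((\<Sum>i<k. (real_of_int (x i + y i))\<^sup>2) + (\<Sum>i<k. (real_of_int (x i + z i))\<^sup>2)
      + (\<Sum>i<k. (real_of_int (y i + z i))\<^sup>2))"
    by (simp add: sum.distrib flip: sum_distrib_left)
  also have "\<dots> < 9 * R" using assms by (auto simp: near_def)
  finally show False using assms by (simp add: near_def)
qed

text \<open>The four inner products add up to that of \<open>x + x'\<close> and
  \<open>y + y'\<close>, which is at most the mean of the squared norms and hence below
  \<open>R\<close>; each of the four therefore needs to be only \<open>R / 4\<close>.\<close>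

lemma near_dot_K4_free:
  assumes "near k R x x'" "near k R y y'"
    and "R \<le> 4 * dot k x y" "R \<le> 4 * dot k x y'" "R \<le> 4 * dot k x' y" "R \<le> 4 * dot k x' y'"
  shows False
proof -
  have "R \<le> dot k x y + dot k x y' + (dot k x' y + dot k x' y')" using assms(3-6) by linarith
  also have "\<dots> = (\<Sum>i<k. real_of_int (x i + x' i) * real_of_int (y i + y' i))"
    by (simp add: dot_def algebra_simps flip: sum.distrib)
  also have "\<dots> \<le> (\<Sum>i<k. ((real_of_int (x i + x' i))\<^sup>2 + (real_of_int (y i + y' i))\<^sup>2) / 2)"
  proof (rule sum_mono)
    fix i
    have "a * b \<le> (a\<^sup>2 + b\<^sup>2) / 2" for a b :: real
      using zero_le_power2[of "a - b"] by (simp add: power2_eq_square algebra_simps)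
    then show "real_of_int (x i + x' i) * real_of_int (y i + y' i)
        \<le> ((real_of_int (x i + x' i))\<^sup>2 + (real_of_int (y i + y' i))\<^sup>2) / 2" .
  qed
  also have "\<dots> = ((\<Sum>i<k. (real_of_int (x i + x' i))\<^sup>2) + (\<Sum>i<k. (real_of_int (y i + y' i))\<^sup>2)) / 2"
    by (simp add: sum.distrib flip: sum_divide_distrib)
  also have "\<dots> < R" using assms(1,2) by (auto simp: near_def)
  finally show False by simp
qed

text \<open>Points with few wide coordinates are rare and are discarded. The others satisfy
  \<open>4 * dot k x x \<ge> k * h\<^sup>2 / 8 \<ge> 9 * R\<close>, the source of the 72, so an
  almost antipodal pair of them is \<open>near\<close>.\<close>

lemma near_independent_sets_small:
  assumes A: "A \<subseteq> grid h k" "\<And>x y. x \<in> A \<Longrightarrow> y \<in> A \<Longrightarrow> \<not> near k R x y" and \<delta>: "\<delta> > 0"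
    and R: "32 * (real (2 * h + 1))\<^sup>2 * ln (1 / \<delta>) + 2 * real k \<le> R" "72 * R \<le> real k * (real h)\<^sup>2"
  shows "real (card A) \<le> (\<delta> + (24 / 25) ^ k) * real (card (grid h k))"
proof -
  define B where "B = {x \<in> grid h k. 8 * card (wide h k x x) < k}"
  have big: "9 * R \<le> 4 * dot k x x" if "k \<le> 8 * card (wide h k x x)" for x
  proof -
    have "real k / 8 * ((real h)\<^sup>2 / 4) \<le> real (card (wide h k x x)) * ((real h)\<^sup>2 / 4)"
      using that by (intro mult_right_mono) auto
    also have "\<dots> = (\<Sum>i\<in>wide h k x x. (real h)\<^sup>2 / 4)" by simp
    also have "\<dots> \<le> (\<Sum>i\<in>wide h k x x. real_of_int (x i) * real_of_int (x i))"
    proof (rule sum_mono)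
      fix i assume "i \<in> wide h k x x"
      then have "real h / 2 \<le> \<bar>real_of_int (x i)\<bar>" by (auto simp: wide_def)
      then have "(real h / 2)\<^sup>2 \<le> \<bar>real_of_int (x i)\<bar>\<^sup>2" by (intro power_mono) auto
      then show "(real h)\<^sup>2 / 4 \<le> real_of_int (x i) * real_of_int (x i)"
        by (simp add: power_divide power2_eq_square)
    qed
    also have "\<dots> \<le> dot k x x"
      unfolding dot_def by (intro sum_mono2) (auto simp: wide_def)
    finally show ?thesis using R(2) by simp
  qed
  have finA: "finite A" using A(1) by (rule finite_subset) simp
  have "real (card (A - B)) \<le> \<delta> * real (card (grid h k))"
  proof (rule ccontr)
    assume "\<not> ?thesis"
    then obtain x y where xy: "x \<in> A - B" "y \<in> A - B"
      and "(\<Sum>i<k. (real_of_int (x i + y i))\<^sup>2) < 32 * (real (2 * h + 1))\<^sup>2 * ln (1 / \<delta>) + 2 * real k"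
      using dense_set_has_almost_antipodal_pair[of "A - B" h k \<delta>] A(1) \<delta> by (meson Diff_subset not_le subset_trans)
    moreover have "9 * R \<le> 4 * dot k x x" "9 * R \<le> 4 * dot k y y"
      using xy A(1) by (auto simp: B_def intro!: big)
    ultimately have "near k R x y" unfolding near_def using R(1) by linarith
    then show False using A(2) xy by blast
  qed
  moreover have "real (card B) \<le> (24 / 25) ^ k * real (card (grid h k))"
    unfolding B_def by (rule few_points_with_few_wide_coordinates)
  moreover have "card A \<le> card (A - B) + card B"
  proof -
    have "card A \<le> card ((A - B) \<union> B)" using finA by (intro card_mono) (auto simp: B_def)
    then show ?thesis using card_Un_le[of "A - B" B] by linarith
  qed
  ultimately show ?thesis by (simp add: algebra_simps)
qed

section \<open>Blow-ups\<close>

text \<open>As \<open>RT\<close> is a maximum, the point is that the set of edge counts is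
  finite.\<close>

lemma card_edges_le_RT:
  fixes G :: "nat ugraph"
  assumes "simple_graph G" "verts G = {..<n}" "independence_number G < m" "\<not> contains_copy G H"
  shows "card (edges G) \<le> RT n H m"
  unfolding RT_def
proof (rule Max_ge)
  have fin: "finite (nsets {..<n} 2)" by (simp add: finite_imp_finite_nsets)
  have "{card (edges G) | G :: nat ugraph. simple_graph G \<and> verts G = {..<n} \<and>
      independence_number G < m \<and> \<not> contains_copy G H} \<subseteq> {..card (nsets {..<n} 2)}"
    using card_mono[OF fin] by (auto simp only: simple_graph_def atMost_iff)
  then show "finite {card (edges G) | G :: nat ugraph. simple_graph G \<and> verts G = {..<n} \<and>
      independence_number G < m \<and> \<not> contains_copy G H}" by (rule finite_subset) simp
qed (use assms in blast)

lemma independence_number_less: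
  assumes "finite (verts G)"
    and "\<And>S. S \<subseteq> verts G \<Longrightarrow> indep S (edges G) \<Longrightarrow> card S < m"
  shows "independence_number G < m"
proof -
  have eq: "{card S | S. S \<subseteq> verts G \<and> indep S (edges G)} = card ` {S. S \<subseteq> verts G \<and> indep S (edges G)}"
    by auto
  have "{} \<in> {S. S \<subseteq> verts G \<and> indep S (edges G)}" by (simp add: indep_def)
  then show ?thesis
    unfolding independence_number_def eq using assms by (subst Max_less_iff) auto
qed

lemma contains_K4D:
  assumes "contains_copy G (complete_graph 4)"
  obtains a b c d where "{a, b} \<in> edges G" "{a, c} \<in> edges G" "{a, d} \<in> edges G"
    "{b, c} \<in> edges G" "{b, d} \<in> edges G" "{c, d} \<in> edges G"
proof -
  obtain f where f: "\<And>e. e \<in> nsets {..<4::nat} 2 \<Longrightarrow> f ` e \<in> edges G"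
    using assms unfolding contains_copy_def complete_graph_def edges_def verts_def by auto
  have "{f i, f j} \<in> edges G" if "i < 4" "j < 4" "i \<noteq> j" for i j
    using f[of "{i, j}"] that by (auto simp: nsets_def)
  then show ?thesis by (intro that[of "f 0" "f 1" "f 2" "f 3"]) auto
qed

text \<open>Every label \<open>l\<close> becomes an independent class of \<open>c l\<close>
  vertices, and adjacent labels are joined completely. The labels of an independent set are pairwise
  nonadjacent, so \<open>ind\<close> bounds it by their total weight. \<open>D\<close> holds each
  label edge in at most one direction, so that no edge is counted twice.\<close>

lemma RT_K4_ge_blowup:
  fixes adj :: "'l \<Rightarrow> 'l \<Rightarrow> bool" and c :: "'l \<Rightarrow> nat"
  assumes fin: "finite \<Lambda>" and n: "(\<Sum>l\<in>\<Lambda>. c l) = n"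
    and sym: "\<And>a b. adj a b \<Longrightarrow> adj b a" and irrefl: "\<And>a. \<not> adj a a"
    and K4: "\<And>a b c d. adj a b \<Longrightarrow> adj a c \<Longrightarrow> adj a d \<Longrightarrow> adj b c \<Longrightarrow> adj b d \<Longrightarrow> adj c d \<Longrightarrow> False"
    and ind: "\<And>I. I \<subseteq> \<Lambda> \<Longrightarrow> (\<And>a b. a \<in> I \<Longrightarrow> b \<in> I \<Longrightarrow> \<not> adj a b) \<Longrightarrow> (\<Sum>l\<in>I. c l) < m"
    and D: "D \<subseteq> \<Lambda> \<times> \<Lambda>" "\<And>a b. (a, b) \<in> D \<Longrightarrow> adj a b" "\<And>a b. (a, b) \<in> D \<Longrightarrow> (b, a) \<notin> D"
  shows "(\<Sum>(a, b)\<in>D. c a * c b) \<le> RT n (complete_graph 4) m"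
proof -
  define V where "V = (SIGMA l:\<Lambda>. {..<c l})"
  have V: "finite V" "card V = n" using fin n by (simp_all add: V_def)
  then obtain f where f: "bij_betw f {..<n} V"
    using finite_same_card_bij[of "{..<n}" V] by auto
  define lab where "lab i = fst (f i)" for i
  define F where "F l = {i. i < n \<and> lab i = l}" for l
  have finF: "finite (F l)" for l by (simp add: F_def)
  have lab: "lab i \<in> \<Lambda>" if "i < n" for i
    using bij_betw_apply[OF f, of i] that by (auto simp: lab_def V_def)
  have cardF: "card (F l) = c l" if "l \<in> \<Lambda>" for l
  proof -
    have "f ` F l = {l} \<times> {..<c l}"
    proof (intro equalityI subsetI)
      fix p assume "p \<in> f ` F l"
      then obtain i where i: "i < n" "fst (f i) = l" "p = f i" unfolding F_def lab_def by blast
      then have "f i \<in> V" using bij_betw_apply[OF f] by simp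
      then show "p \<in> {l} \<times> {..<c l}" using i(2,3) by (cases "f i") (simp add: V_def)
    next
      fix p assume p: "p \<in> {l} \<times> {..<c l}"
      then have "p \<in> V" using that by (auto simp: V_def)
      then obtain i where "i \<in> {..<n}" "p = f i" using bij_betw_imp_surj_on[OF f] by blast
      then show "p \<in> f ` F l" using p by (auto simp: F_def lab_def)
    qed
    moreover have "inj_on f (F l)"
      using bij_betw_imp_inj_on[OF f] by (rule inj_on_subset) (auto simp: F_def)
    ultimately have "card (F l) = card ({l} \<times> {..<c l})" by (metis card_image)
    then show ?thesis by (simp add: card_cartesian_product)
  qed
  define E where "E = {{i, j} | i j. i < n \<and> j < n \<and> adj (lab i) (lab j)}"
  define G where "G = ({..<n}, E)"
  have G: "verts G = {..<n}" "edges G = E" by (simp_all add: G_def verts_def edges_def)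
  have adjE: "adj (lab i) (lab j)" if "{i, j} \<in> E" for i j
    using that sym unfolding E_def by (auto simp: doubleton_eq_iff)
  have simple: "simple_graph G"
    using irrefl by (auto simp: simple_graph_def G E_def nsets_def card_insert_if; metis)
  have "\<not> contains_copy G (complete_graph 4)"
  proof
    assume "contains_copy G (complete_graph 4)"
    then obtain a b c d where "{a, b} \<in> E" "{a, c} \<in> E" "{a, d} \<in> E" "{b, c} \<in> E" "{b, d} \<in> E" "{c, d} \<in> E"
      unfolding G(2)[symmetric] by (rule contains_K4D)
    then show False using adjE K4 by (meson)
  qed
  moreover have "independence_number G < m"
  proof (rule independence_number_less)
    fix S assume S: "S \<subseteq> verts G" "indep S (edges G)"
    have "card S \<le> card (\<Union>l\<in>lab ` S. F l)"
      using S(1) by (intro card_mono) (auto simp: F_def G intro: finite_subset)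
    also have "\<dots> \<le> (\<Sum>l\<in>lab ` S. card (F l))"
      using S(1) by (intro card_UN_le) (auto simp: G intro: finite_subset)
    also have "\<dots> = (\<Sum>l\<in>lab ` S. c l)"
      using S(1) lab cardF by (intro sum.cong) (auto simp: G)
    also have "\<dots> < m"
    proof (rule ind)
      show "lab ` S \<subseteq> \<Lambda>" using S(1) lab by (auto simp: G)
      fix a b assume "a \<in> lab ` S" "b \<in> lab ` S"
      then obtain i j where ij: "i \<in> S" "j \<in> S" "a = lab i" "b = lab j" by blast
      show "\<not> adj a b"
      proof
        assume ab: "adj a b"
        then have "i \<noteq> j" using ij irrefl by auto
        moreover have "{i, j} \<in> E" using ab ij S(1) by (auto simp: E_def G)
        ultimately show False using S(2) ij(1,2) unfolding indep_def G by blast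
      qed
    qed
    finally show "card S < m" .
  qed (simp add: G)
  ultimately have "card E \<le> RT n (complete_graph 4) m"
    using card_edges_le_RT[OF simple, of n m] G by simp
  moreover have "(\<Sum>(a, b)\<in>D. c a * c b) \<le> card E"
  proof -
    define W where "W = (\<Union>p\<in>D. F (fst p) \<times> F (snd p))"
    have finD: "finite D" using D(1) fin by (auto intro: finite_subset)
    have "(\<Sum>(a, b)\<in>D. c a * c b) = (\<Sum>p\<in>D. card (F (fst p) \<times> F (snd p)))"
      using D(1) by (intro sum.cong) (auto simp: cardF card_cartesian_product subset_iff)
    also have "\<dots> = card W"
      unfolding W_def using finD finF by (subst card_UN_disjoint) (auto simp: F_def)
    \<comment> \<open>An unordered edge determines its ordered pair because \<open>D\<close> never
      contains both directions.\<close>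
    also have "card W = card ((\<lambda>(i, j). {i, j}) ` W)"
    proof (rule card_image[symmetric], rule inj_onI)
      fix p q assume pq: "p \<in> W" "q \<in> W" "(\<lambda>(i, j). {i, j}) p = (\<lambda>(i, j). {i, j}) q"
      have "(lab (fst p), lab (snd p)) \<in> D" "(lab (fst q), lab (snd q)) \<in> D"
        using pq(1,2) by (auto simp: W_def F_def)
      then have "\<not> (fst p = snd q \<and> snd p = fst q)" using D(3) by metis
      then show "p = q" using pq(3) by (auto simp: case_prod_unfold doubleton_eq_iff prod_eq_iff)
    qed
    also have "\<dots> \<le> card E"
    proof (rule card_mono)
      have "E \<subseteq> Pow {..<n}" by (auto simp: E_def)
      then show "finite E" by (rule finite_subset) simp
      show "(\<lambda>(i, j). {i, j}) ` W \<subseteq> E"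
        using D(2) unfolding W_def E_def F_def by fastforce
    qed
    finally show ?thesis .
  qed
  ultimately show ?thesis by simp
qed

section \<open>The hub graph\<close>

text \<open>\<open>Rest\<close> takes the vertices left over by rounding; they are isolated.\<close>

datatype 'g part = HubX | HubY | PartX 'g | PartY 'g | Rest

fun hub_adj :: "('g \<Rightarrow> 'g \<Rightarrow> bool) \<Rightarrow> ('g \<Rightarrow> 'g \<Rightarrow> bool) \<Rightarrow> 'g part \<Rightarrow> 'g part \<Rightarrow> bool" where
  "hub_adj N C HubX b = (case b of HubY \<Rightarrow> True | PartX _ \<Rightarrow> True | _ \<Rightarrow> False)"
| "hub_adj N C HubY b = (case b of HubX \<Rightarrow> True | PartY _ \<Rightarrow> True | _ \<Rightarrow> False)"
| "hub_adj N C (PartX x) b = (case b of HubX \<Rightarrow> True | PartX y \<Rightarrow> N x y | PartY y \<Rightarrow> C x y | _ \<Rightarrow> False)"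
| "hub_adj N C (PartY y) b = (case b of HubY \<Rightarrow> True | PartY z \<Rightarrow> N y z | PartX x \<Rightarrow> C x y | _ \<Rightarrow> False)"
| "hub_adj N C Rest b = False"

fun part_size :: "nat \<Rightarrow> nat \<Rightarrow> nat \<Rightarrow> 'g part \<Rightarrow> nat" where
  "part_size s q r HubX = s"
| "part_size s q r HubY = s"
| "part_size s q r (PartX _) = q"
| "part_size s q r (PartY _) = q"
| "part_size s q r Rest = r"

text \<open>The hubs have no common neighbour, and a clique containing one hub has a triangle of
  \<open>N\<close> in the copy joined to it. Without hubs, three vertices in one copy form such a
  triangle, and two in each copy contradict \<open>K4\<close>.\<close>

lemma hub_adj_K4_free:
  assumes tri: "\<And>x y z. N x y \<Longrightarrow> N x z \<Longrightarrow> N y z \<Longrightarrow> False"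
    and K4: "\<And>x x' y y'. N x x' \<Longrightarrow> N y y' \<Longrightarrow> C x y \<Longrightarrow> C x y' \<Longrightarrow> C x' y \<Longrightarrow> C x' y' \<Longrightarrow> False"
    and "hub_adj N C a b" "hub_adj N C a c" "hub_adj N C a d" "hub_adj N C b c" "hub_adj N C b d" "hub_adj N C c d"
  shows False
  using assms(3-8)
  by (cases a; cases b; simp; cases c; simp; cases d; simp; blast intro: tri K4)

text \<open>An independent set meets at most one hub and meets each copy in an
  \<open>N\<close>-independent set, whence the form of the hypothesis on \<open>m\<close>. The count
  takes the edges between the hubs, from hubs to copies and between the copies; those inside a copy
  are left out.\<close>

lemma RT_K4_ge_hub_graph:
  fixes Gr :: "'g set"
  assumes Gr: "finite Gr"
    and sym: "\<And>x y. N x y \<Longrightarrow> N y x"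
    and tri: "\<And>x y z. N x y \<Longrightarrow> N x z \<Longrightarrow> N y z \<Longrightarrow> False"
    and K4: "\<And>x x' y y'. N x x' \<Longrightarrow> N y y' \<Longrightarrow> C x y \<Longrightarrow> C x y' \<Longrightarrow> C x' y \<Longrightarrow> C x' y' \<Longrightarrow> False"
    and ind: "\<And>A. A \<subseteq> Gr \<Longrightarrow> (\<And>x y. x \<in> A \<Longrightarrow> y \<in> A \<Longrightarrow> \<not> N x y) \<Longrightarrow> real (card A) \<le> \<delta> * real (card Gr)"
    and n: "2 * s + 2 * (q * card Gr) + r = n"
    and m: "real s + 2 * \<delta> * real (q * card Gr) + real r < real m"
  shows "s\<^sup>2 + 2 * (s * (q * card Gr)) + q\<^sup>2 * card {(x, y) \<in> Gr \<times> Gr. C x y} \<le> RT n (complete_graph 4) m"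
proof -
  let ?adj = "hub_adj N C" and ?c = "part_size s q r"
  define CC where "CC = {(x, y) \<in> Gr \<times> Gr. C x y}"
  define \<Lambda> where "\<Lambda> = {HubX, HubY, Rest} \<union> (PartX ` Gr \<union> PartY ` Gr)"
  define D1 :: "('g part \<times> 'g part) set" where "D1 = insert (HubX, HubY) (Pair (HubX :: 'g part) ` PartX ` Gr \<union> Pair (HubY :: 'g part) ` PartY ` Gr)"
  define D2 where "D2 = (\<lambda>(x, y). (PartX x, PartY y)) ` CC"
  have finCC: "finite CC" unfolding CC_def using Gr by (auto intro: finite_subset[of _ "Gr \<times> Gr"])
  have sumX: "(\<Sum>l\<in>PartX ` A. ?c l) = q * card A" "(\<Sum>l\<in>PartY ` A. ?c l) = q * card A" for A
    by (subst sum.reindex; simp add: inj_on_def mult.commute)+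
  have "(\<Sum>l\<in>\<Lambda>. ?c l) = (s + s + r) + (q * card Gr + q * card Gr)"
  proof -
    have "(\<Sum>l\<in>PartX ` Gr \<union> PartY ` Gr. ?c l) = q * card Gr + q * card Gr"
    proof -
      have "(\<Sum>l\<in>PartX ` Gr \<union> PartY ` Gr. ?c l) = (\<Sum>l\<in>PartX ` Gr. ?c l) + (\<Sum>l\<in>PartY ` Gr. ?c l)"
        using Gr by (intro sum.union_disjoint) auto
      then show ?thesis unfolding sumX .
    qed
    moreover have "(\<Sum>l\<in>\<Lambda>. ?c l) = (\<Sum>l\<in>{HubX, HubY, Rest :: 'g part}. ?c l) + (\<Sum>l\<in>PartX ` Gr \<union> PartY ` Gr. ?c l)"
      unfolding \<Lambda>_def using Gr by (intro sum.union_disjoint) auto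
    ultimately show ?thesis by simp
  qed
  then have sum\<Lambda>: "(\<Sum>l\<in>\<Lambda>. ?c l) = n" using n by simp
  have "(\<Sum>(a, b)\<in>D1 \<union> D2. ?c a * ?c b) \<le> RT n (complete_graph 4) m"
  proof (rule RT_K4_ge_blowup[where adj = ?adj, OF _ sum\<Lambda>])
    show "finite \<Lambda>" using Gr by (simp add: \<Lambda>_def)
    show "?adj b a" if "?adj a b" for a b using that sym by (cases a; cases b) auto
    show "\<not> ?adj a a" for a using tri by (cases a) auto
    show False if "?adj a b" "?adj a c" "?adj a d" "?adj b c" "?adj b d" "?adj c d" for a b c d
      by (rule hub_adj_K4_free[of N C a b c d]) (fact tri, fact K4, fact+)
    have "PartX x \<in> \<Lambda>" "PartY x \<in> \<Lambda>" if "x \<in> Gr" for x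
      using that unfolding \<Lambda>_def by blast+
    moreover have "HubX \<in> \<Lambda>" "HubY \<in> \<Lambda>" unfolding \<Lambda>_def by blast+
    ultimately show "D1 \<union> D2 \<subseteq> \<Lambda> \<times> \<Lambda>" unfolding D1_def D2_def CC_def by fast
    show "?adj a b" if "(a, b) \<in> D1 \<union> D2" for a b
      using that by (auto simp: D1_def D2_def CC_def)
    show "(b, a) \<notin> D1 \<union> D2" if "(a, b) \<in> D1 \<union> D2" for a b
      using that by (auto simp: D1_def D2_def)
    fix I assume I: "I \<subseteq> \<Lambda>" "\<And>a b. a \<in> I \<Longrightarrow> b \<in> I \<Longrightarrow> \<not> ?adj a b"
    define A B where "A = {x. PartX x \<in> I}" and "B = {x. PartY x \<in> I}"
    define hub :: "'g part" where "hub = (if HubX \<in> I then HubX else HubY)"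
    have AB: "A \<subseteq> Gr" "B \<subseteq> Gr" using I(1) by (auto simp: A_def B_def \<Lambda>_def)
    then have fin: "finite A" "finite B" using Gr by (auto intro: finite_subset)
    have "\<not> N x y" if "x \<in> A" "y \<in> A" for x y using I(2)[of "PartX x" "PartX y"] that by (simp add: A_def)
    then have cA: "real (card A) \<le> \<delta> * real (card Gr)" using ind AB by blast
    have "\<not> N x y" if "x \<in> B" "y \<in> B" for x y using I(2)[of "PartY x" "PartY y"] that by (simp add: B_def)
    then have cB: "real (card B) \<le> \<delta> * real (card Gr)" using ind AB by blast
    have "\<not> (HubX \<in> I \<and> HubY \<in> I)" using I(2)[of HubX HubY] by auto
    then have "I \<subseteq> {hub, Rest} \<union> (PartX ` A \<union> PartY ` B)"
      using I(1) by (auto simp: A_def B_def \<Lambda>_def hub_def)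
    then have "(\<Sum>l\<in>I. ?c l) \<le> (\<Sum>l\<in>{hub, Rest} \<union> (PartX ` A \<union> PartY ` B). ?c l)"
      using fin by (intro sum_mono2) auto
    also have "\<dots> = (\<Sum>l\<in>{hub, Rest}. ?c l) + ((\<Sum>l\<in>PartX ` A. ?c l) + (\<Sum>l\<in>PartY ` B. ?c l))"
    proof -
      have "(\<Sum>l\<in>PartX ` A \<union> PartY ` B. ?c l) = (\<Sum>l\<in>PartX ` A. ?c l) + (\<Sum>l\<in>PartY ` B. ?c l)"
        using fin by (intro sum.union_disjoint) auto
      moreover have "(\<Sum>l\<in>{hub, Rest} \<union> (PartX ` A \<union> PartY ` B). ?c l)
          = (\<Sum>l\<in>{hub, Rest}. ?c l) + (\<Sum>l\<in>PartX ` A \<union> PartY ` B. ?c l)"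
        using fin by (intro sum.union_disjoint) (auto simp: hub_def)
      ultimately show ?thesis by simp
    qed
    also have "\<dots> = s + r + (q * card A + q * card B)"
      unfolding sumX by (simp add: hub_def)
    finally have "real (\<Sum>l\<in>I. ?c l) \<le> real (s + r + (q * card A + q * card B))"
      by (simp only: of_nat_le_iff)
    also have "\<dots> = real s + real r + (real q * real (card A) + real q * real (card B))" by simp
    also have "\<dots> \<le> real s + real r + (real q * (\<delta> * real (card Gr)) + real q * (\<delta> * real (card Gr)))"
      using cA cB by (intro add_mono mult_left_mono) auto
    also have "\<dots> = real s + 2 * \<delta> * real (q * card Gr) + real r" by simp
    also note m
    finally show "(\<Sum>l\<in>I. ?c l) < m" by (simp only: of_nat_less_iff)
  qed
  moreover have "(\<Sum>(a, b)\<in>D1 \<union> D2. ?c a * ?c b) = s\<^sup>2 + 2 * (s * (q * card Gr)) + q\<^sup>2 * card CC"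
  proof -
    have "(\<Sum>(a, b)\<in>D2. ?c a * ?c b) = q\<^sup>2 * card CC"
      unfolding D2_def
      by (subst sum.reindex) (auto simp: inj_on_def case_prod_unfold power2_eq_square mult.commute)
    moreover have "(\<Sum>(a, b)\<in>Pair (HubX :: 'g part) ` PartX ` Gr. ?c a * ?c b) = s * (q * card Gr)"
        "(\<Sum>(a, b)\<in>Pair (HubY :: 'g part) ` PartY ` Gr. ?c a * ?c b) = s * (q * card Gr)"
      unfolding image_image by (subst sum.reindex; simp add: inj_on_def mult_ac)+
    moreover have "(\<Sum>(a, b)\<in>D1. ?c a * ?c b) = s\<^sup>2 + ((\<Sum>(a, b)\<in>Pair (HubX :: 'g part) ` PartX ` Gr. ?c a * ?c b)
        + (\<Sum>(a, b)\<in>Pair (HubY :: 'g part) ` PartY ` Gr. ?c a * ?c b))"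
    proof -
      have "(\<Sum>(a, b)\<in>D1. ?c a * ?c b) = s\<^sup>2 + (\<Sum>(a, b)\<in>Pair (HubX :: 'g part) ` PartX ` Gr \<union> Pair (HubY :: 'g part) ` PartY ` Gr. ?c a * ?c b)"
        unfolding D1_def using Gr by (subst sum.insert) (auto simp: power2_eq_square)
      also have "(\<Sum>(a, b)\<in>Pair (HubX :: 'g part) ` PartX ` Gr \<union> Pair (HubY :: 'g part) ` PartY ` Gr. ?c a * ?c b)
        = (\<Sum>(a, b)\<in>Pair (HubX :: 'g part) ` PartX ` Gr. ?c a * ?c b) + (\<Sum>(a, b)\<in>Pair (HubY :: 'g part) ` PartY ` Gr. ?c a * ?c b)"
        using Gr by (intro sum.union_disjoint) auto
      finally show ?thesis .
    qed
    moreover have "(\<Sum>(a, b)\<in>D1 \<union> D2. ?c a * ?c b) = (\<Sum>(a, b)\<in>D1. ?c a * ?c b) + (\<Sum>(a, b)\<in>D2. ?c a * ?c b)"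
      using Gr finCC by (intro sum.union_disjoint) (auto simp: D1_def D2_def)
    ultimately show ?thesis by simp
  qed
  ultimately show ?thesis by (simp add: CC_def)
qed

text \<open>For \<open>r = 0\<close> and \<open>\<beta> = 0\<close> the right side is
  \<open>n\<^sup>2 / 8 + s * n / 3 + s * (n - 3 * s) / 6\<close>, and \<open>3 * s \<le> n\<close>
  makes the last term nonnegative.\<close>

lemma hub_graph_edge_estimate:
  fixes n s r \<beta> :: real
  assumes "0 \<le> s" "3 * s \<le> n" "0 \<le> r" "r \<le> n - 2 * s" "0 \<le> \<beta>"
  shows "n\<^sup>2 / 8 + s * n / 3 - 5 / 4 * n * r - \<beta> * n\<^sup>2 / 4
    \<le> s\<^sup>2 + s * (n - 2 * s - r) + (1 / 2 - \<beta>) * ((n - 2 * s - r) / 2)\<^sup>2"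
proof -
  define P where "P = n - 2 * s"
  have n: "0 \<le> n" "P \<le> n" "0 \<le> P - r" "P - r \<le> n" using assms by (auto simp: P_def)
  have "0 \<le> s * (n - 3 * s)" using assms by simp
  moreover have "s * r \<le> n * r" using assms n by (intro mult_right_mono) auto
  moreover have "P * r \<le> n * r" using assms n by (intro mult_right_mono) auto
  moreover have "\<beta> * (P - r)\<^sup>2 \<le> \<beta> * n\<^sup>2" using assms n by (intro mult_left_mono power_mono) auto
  moreover have "0 \<le> r\<^sup>2" by simp
  \<comment> \<open>The factor 24 clears the denominators and leaves a claim linear in the products
    bounded above.\<close>
  moreover have "24 * (s\<^sup>2 + s * (P - r) + (1 / 2 - \<beta>) * ((P - r) / 2)\<^sup>2)
    = 3 * n\<^sup>2 + 8 * (s * n) + 4 * (s * (n - 3 * s)) - 24 * (s * r) - 6 * (P * r) + 3 * r\<^sup>2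
      - 6 * (\<beta> * (P - r)\<^sup>2)"
    by (simp add: P_def field_simps power2_eq_square)
  ultimately have "3 * n\<^sup>2 + 8 * (s * n) - 30 * (n * r) - 6 * (\<beta> * n\<^sup>2)
      \<le> 24 * (s\<^sup>2 + s * (P - r) + (1 / 2 - \<beta>) * ((P - r) / 2)\<^sup>2)"
    by linarith
  then show ?thesis unfolding P_def by simp
qed

text \<open>\<open>\<delta>'\<close> bounds the density of independent sets in a copy,
  \<open>\<beta>\<close> bounds how far the density between the copies falls below 1/2, and
  \<open>M\<close> is the number of grid points.\<close>

lemma RT_K4_ge_of_grid:
  assumes h: "h > 0" and k: "k > 0" and \<delta>: "\<delta> > 0"
    and R: "0 < R" "32 * (real (2 * h + 1))\<^sup>2 * ln (1 / \<delta>) + 2 * real k \<le> R"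
      "72 * R \<le> real k * (real h)\<^sup>2" "R \<le> real \<rho> * (real h)\<^sup>2"
    and \<delta>': "\<delta>' = \<delta> + (24 / 25) ^ k"
    and \<beta>: "\<beta> = (real \<rho> / sqrt (real k / 8) + (24 / 25) ^ k) / 2"
    and M: "M = (2 * h + 1) ^ k"
    and m: "3 * m \<le> n" "\<delta>' * real n + 2 * real M + 1 \<le> real m"
  shows "(real n)\<^sup>2 / 8 + real m * real n / 3 - real n * (\<delta>' * real n + \<beta> * real n + 4 * real M)
    \<le> real (RT n (complete_graph 4) m)"
proof -
  \<comment> \<open>The hubs fall short of \<open>m\<close> by \<open>t\<close>. An independent set
    has at most \<open>\<delta>' * n\<close> vertices in the copies and fewer than
    \<open>2 * M\<close> in \<open>Rest\<close>, so it stays below \<open>s + t = m\<close>.\<close>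
  define t where "t = nat \<lfloor>\<delta>' * real n + 2 * real M\<rfloor> + 1"
  have \<delta>'0: "0 \<le> \<delta>'" using \<delta> \<delta>' by simp
  have \<beta>0: "0 \<le> \<beta>" unfolding \<beta> by simp
  have M0: "M > 0" "card (grid h k) = M" by (auto simp: M card_grid)
  have "0 \<le> \<delta>' * real n + 2 * real M" using \<delta>'0 by simp
  then have t: "\<delta>' * real n + 2 * real M < real t" "real t \<le> \<delta>' * real n + 2 * real M + 1"
  proof -
    have "x < real (nat \<lfloor>x\<rfloor> + 1) \<and> real (nat \<lfloor>x\<rfloor> + 1) \<le> x + 1" if "0 \<le> x" for x :: real
      using that floor_correct[of x] by (simp add: of_nat_nat add.commute)
    then show "\<delta>' * real n + 2 * real M < real t" "real t \<le> \<delta>' * real n + 2 * real M + 1"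
      unfolding t_def using \<open>0 \<le> \<delta>' * real n + 2 * real M\<close> by blast+
  qed
  then have tm: "t \<le> m" using m(2) by linarith
  define s where "s = m - t"
  \<comment> \<open>Each of the \<open>2 * M\<close> points in the two copies becomes
    \<open>q\<close> vertices; the remainder goes to \<open>Rest\<close>.\<close>
  define q r where "q = (n - 2 * s) div (2 * M)" and "r = (n - 2 * s) mod (2 * M)"
  have s: "real s = real m - real t" "2 * s \<le> n" using tm m(1) by (auto simp: s_def)
  have r: "r < 2 * M" using M0 by (simp add: r_def)
  have "2 * M * q + r = n - 2 * s" by (simp add: q_def r_def)
  then have n: "2 * s + 2 * (q * card (grid h k)) + r = n" using s(2) M0 by (simp add: mult_ac)
  have N: "2 * real (q * M) = real n - 2 * real s - real r"
    using arg_cong[OF n, of real] M0 by simp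
  have "s\<^sup>2 + 2 * (s * (q * card (grid h k))) +
      q\<^sup>2 * card {(x, y) \<in> grid h k \<times> grid h k. R \<le> 4 * dot k x y} \<le> RT n (complete_graph 4) m"
  proof (rule RT_K4_ge_hub_graph[where N = "near k R" and \<delta> = \<delta>'])
    have "2 * \<delta>' * real (q * card (grid h k)) \<le> \<delta>' * real n"
    proof -
      have "\<delta>' * (2 * real (q * M)) \<le> \<delta>' * real n"
        by (rule mult_left_mono[OF _ \<delta>'0]) (use N in linarith)
      then show ?thesis unfolding M0(2) by (simp only: mult_ac)
    qed
    then show "real s + 2 * \<delta>' * real (q * card (grid h k)) + real r < real m"
      using t(1) s(1) r by linarith
    show "real (card A) \<le> \<delta>' * real (card (grid h k))"
      if "A \<subseteq> grid h k" "\<And>x y. x \<in> A \<Longrightarrow> y \<in> A \<Longrightarrow> \<not> near k R x y" for A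
      unfolding \<delta>' by (rule near_independent_sets_small[OF that \<delta> R(2,3)])
  qed (simp, erule near_sym, erule (2) near_triangle_free, erule (5) near_dot_K4_free, rule n)
  then have "real (s\<^sup>2 + 2 * (s * (q * card (grid h k))) +
      q\<^sup>2 * card {(x, y) \<in> grid h k \<times> grid h k. R \<le> 4 * dot k x y}) \<le> real (RT n (complete_graph 4) m)"
    by (simp only: of_nat_le_iff)
  then have "(real s)\<^sup>2 + real s * (2 * real (q * M)) +
      (real q)\<^sup>2 * real (card {(x, y) \<in> grid h k \<times> grid h k. R \<le> 4 * dot k x y})
      \<le> real (RT n (complete_graph 4) m)"
    unfolding M0(2) by (simp add: mult_ac)
  moreover have "(real q)\<^sup>2 * ((1 / 2 - \<beta>) * (real M)\<^sup>2)
      \<le> (real q)\<^sup>2 * real (card {(x, y) \<in> grid h k \<times> grid h k. R \<le> 4 * dot k x y})"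
    using many_pairs_with_large_dot[OF h k R(1,4)] unfolding \<beta> M0(2) by (intro mult_left_mono) auto
  moreover have "(real q)\<^sup>2 * ((1 / 2 - \<beta>) * (real M)\<^sup>2) = (1 / 2 - \<beta>) * ((2 * real (q * M)) / 2)\<^sup>2"
    by (simp add: power_mult_distrib)
  ultimately have "(real s)\<^sup>2 + real s * (2 * real (q * M)) + (1 / 2 - \<beta>) * ((2 * real (q * M)) / 2)\<^sup>2
      \<le> real (RT n (complete_graph 4) m)" by linarith
  moreover have "(real n)\<^sup>2 / 8 + real s * real n / 3 - 5 / 4 * real n * real r - \<beta> * (real n)\<^sup>2 / 4
      \<le> (real s)\<^sup>2 + real s * (2 * real (q * M)) + (1 / 2 - \<beta>) * ((2 * real (q * M)) / 2)\<^sup>2"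
    unfolding N
  proof (rule hub_graph_edge_estimate)
    show "3 * real s \<le> real n" using m(1) by (simp add: s_def)
    show "real r \<le> real n - 2 * real s" using N by (smt (verit) of_nat_0_le_iff)
  qed (use \<beta>0 in auto)
  moreover have "(real n)\<^sup>2 / 8 + real m * real n / 3 - real n * (\<delta>' * real n + \<beta> * real n + 4 * real M)
    \<le> (real n)\<^sup>2 / 8 + real s * real n / 3 - 5 / 4 * real n * real r - \<beta> * (real n)\<^sup>2 / 4"
  proof -
    have "real t / 3 + 5 / 4 * real r + \<beta> * real n / 4 \<le> \<delta>' * real n + \<beta> * real n + 4 * real M"
    proof -
      have "1 \<le> real M" "real r \<le> 2 * real M" using M0 r by auto
      moreover have "0 \<le> \<delta>' * real n" "0 \<le> \<beta> * real n" using \<delta>'0 \<beta>0 by auto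
      ultimately show ?thesis using t(2) by linarith
    qed
    then have "real n * (real t / 3 + 5 / 4 * real r + \<beta> * real n / 4)
        \<le> real n * (\<delta>' * real n + \<beta> * real n + 4 * real M)" by (rule mult_left_mono) simp
    moreover have "(real n)\<^sup>2 / 8 + real s * real n / 3 - 5 / 4 * real n * real r - \<beta> * (real n)\<^sup>2 / 4
        = (real n)\<^sup>2 / 8 + real m * real n / 3 - real n * (real t / 3 + 5 / 4 * real r + \<beta> * real n / 4)"
      unfolding s(1) by (simp add: field_simps power2_eq_square)
    ultimately show ?thesis by simp
  qed
  ultimately show ?thesis by linarith
qed

section \<open>Choice of the parameters\<close>

text \<open>The order of magnitude that \<open>m / n\<close> has to exceed; all relative errors will
  be bounded by multiples of it.\<close>

definition gap :: "nat \<Rightarrow> real" where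
  "gap n = ln (ln (real n)) powr (3/2) / ln (real n) powr (1/2)"

text \<open>\<open>\<kappa>\<close> is the dimension before rounding down, which explains
  \<open>\<kappa> - 1\<close>. The 4 in it makes \<open>l powr \<kappa> = exp (l / 4)\<close>, so
  that the grid will have at most \<open>n powr (1 / 4)\<close> points.\<close>

lemma eventually_parameter_bounds:
  "\<forall>\<^sub>F n in sequentially. let l = ln (real n); ll = ln l; \<kappa> = l / (4 * ll) in
     n > 0 \<and> l > 0 \<and> ll > 0 \<and> 648 * (32 * ll + 1) \<le> \<kappa> - 1 \<and> 2 * \<kappa> + 1 \<le> l \<and>
     4 * exp (l / 4) \<le> gap n * real n \<and> 1 / l \<le> gap n \<and> (24 / 25) powr (\<kappa> - 1) \<le> gap n \<and>
     288 * ll + 10 \<le> 300 * ll \<and> l / (36 * ll) \<le> (\<kappa> - 1) / 8"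
  unfolding Let_def gap_def eventually_conj_iff
proof (intro conjI)
  show "eventually ((<) 0) sequentially" by (rule eventually_gt_at_top)
qed real_asymp+

lemma RT_K4_ge_eventually:
  "\<forall>\<^sub>F n in sequentially. \<forall>m. 3 * m \<le> n \<longrightarrow> 4 * (gap n * real n) \<le> real m \<longrightarrow>
     (real n)\<^sup>2 / 8 + real m * real n / 3 - real n * (1010 * (gap n * real n)) \<le> real (RT n (complete_graph 4) m)"
  using eventually_parameter_bounds
proof eventually_elim
  case (elim n)
  define l ll \<kappa> where "l = ln (real n)" and "ll = ln l" and "\<kappa> = l / (4 * ll)"
  have n: "n > 0" and l: "l > 0" and ll: "ll > 0" and \<kappa>: "648 * (32 * ll + 1) \<le> \<kappa> - 1" "2 * \<kappa> + 1 \<le> l"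
    and gM: "4 * exp (l / 4) \<le> gap n * real n" and gl: "1 / l \<le> gap n"
    and gk: "(24 / 25) powr (\<kappa> - 1) \<le> gap n"
    and gs: "288 * ll + 10 \<le> 300 * ll" "l / (36 * ll) \<le> (\<kappa> - 1) / 8"
    using elim unfolding Let_def l_def[symmetric] ll_def[symmetric] \<kappa>_def[symmetric] by blast+
  define k where "k = nat \<lfloor>\<kappa>\<rfloor>"
  have \<kappa>0: "\<kappa> > 649" using \<kappa>(1) ll by (simp add: algebra_simps)
  have k: "\<kappa> - 1 \<le> real k" "real k \<le> \<kappa>" "k > 0"
    using \<kappa>0 by (auto simp: k_def)
  define L where "L = real (2 * k + 1)"
  \<comment> \<open>For \<open>\<delta> = 1 / l\<close> one has
    \<open>ln (1 / \<delta>) = ll\<close>, and the \<open>+ 1\<close> absorbs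
    \<open>2 * real k \<le> L\<^sup>2\<close>. The 9 in \<open>\<rho>\<close> below comes from
    \<open>L \<le> 3 * real k\<close>.\<close>
  define R where "R = L\<^sup>2 * (32 * ll + 1)"
  define \<rho> where "\<rho> = nat \<lceil>9 * (32 * ll + 1)\<rceil>"
  define \<delta>' where "\<delta>' = 1 / l + (24 / 25) ^ k"
  define \<beta> where "\<beta> = (real \<rho> / sqrt (real k / 8) + (24 / 25) ^ k) / 2"
  define M where "M = (2 * k + 1) ^ k"
  have L: "0 < L" "L \<le> 3 * real k" using k(3) by (auto simp: L_def)
  have L2: "L\<^sup>2 \<le> 9 * (real k)\<^sup>2"
    using power_mono[OF L(2), of 2] L(1) by (simp add: power_mult_distrib)
  have R9: "R \<le> 9 * (32 * ll + 1) * (real k)\<^sup>2"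
  proof -
    have "R \<le> 9 * (real k)\<^sup>2 * (32 * ll + 1)"
      unfolding R_def using L2 ll by (intro mult_right_mono) auto
    then show ?thesis by (simp only: mult_ac)
  qed
  have R0: "0 < R" using L(1) ll by (simp add: R_def)
  have R1: "32 * (real (2 * k + 1))\<^sup>2 * ln (1 / (1 / l)) + 2 * real k \<le> R"
  proof -
    have "2 * real k \<le> L\<^sup>2" by (simp add: L_def power2_eq_square algebra_simps)
    then have "32 * L\<^sup>2 * ll + 2 * real k \<le> R" by (simp add: R_def algebra_simps)
    then show ?thesis by (simp only: L_def ll_def div_by_1 divide_divide_eq_right mult_1)
  qed
  have R2: "72 * R \<le> real k * (real k)\<^sup>2"
  proof -
    have "72 * R \<le> 72 * (9 * (32 * ll + 1) * (real k)\<^sup>2)" using R9 by (rule mult_left_mono) simp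
    also have "\<dots> = (648 * (32 * ll + 1)) * (real k)\<^sup>2" by simp
    also have "\<dots> \<le> real k * (real k)\<^sup>2" using \<kappa>(1) k(1) by (intro mult_right_mono) auto
    finally show ?thesis .
  qed
  have \<rho>: "9 * (32 * ll + 1) \<le> real \<rho>" "real \<rho> \<le> 288 * ll + 10"
  proof -
    have "x \<le> real (nat \<lceil>x\<rceil>) \<and> real (nat \<lceil>x\<rceil>) \<le> x + 1" if "x > 0" for x :: real
      using that ceiling_correct[of x] by (simp add: of_nat_nat)
    from this[of "9 * (32 * ll + 1)"] show "9 * (32 * ll + 1) \<le> real \<rho>" "real \<rho> \<le> 288 * ll + 10"
      unfolding \<rho>_def using ll by auto
  qed
  have R3: "R \<le> real \<rho> * (real k)\<^sup>2"
    using order_trans[OF R9 mult_right_mono[OF \<rho>(1)]] by simp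
  have pk: "(24 / 25) ^ k \<le> gap n"
  proof -
    have "(24 / 25 :: real) ^ k = (24 / 25) powr real k" by (simp add: powr_realpow)
    also have "\<dots> \<le> (24 / 25) powr (\<kappa> - 1)" using k(1) by (simp add: powr_mono')
    finally show ?thesis using gk by simp
  qed
  have g0: "0 \<le> gap n" by (simp add: gap_def)
  have \<beta>: "\<beta> \<le> 1001 * gap n"
  proof -
    have "l / (36 * ll) \<le> real k / 8" using gs(2) k(1) by simp
    \<comment> \<open>The right side has the order of \<open>ll / sqrt (l / ll)\<close>, from which
      the exponents of \<open>gap\<close> originate.\<close>
    then have "real \<rho> / sqrt (real k / 8) \<le> (300 * ll) / sqrt (l / (36 * ll))"
      using \<rho>(2) gs(1) l ll by (intro frac_le) auto
    also have "sqrt (l / (36 * ll)) = sqrt l / (6 * sqrt ll)"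
      by (simp add: real_sqrt_divide real_sqrt_mult)
    also have "300 * ll / (sqrt l / (6 * sqrt ll)) = 1800 * gap n"
    proof -
      have "ll powr (3 / 2) = ll powr (1 + 1 / 2)" by simp
      also have "\<dots> = ll * sqrt ll" using ll by (simp only: powr_add powr_half_sqrt) simp
      finally show ?thesis using l ll by (simp add: gap_def powr_half_sqrt flip: l_def ll_def)
    qed
    finally show ?thesis unfolding \<beta>_def using pk g0 by simp
  qed
  have \<delta>': "\<delta>' \<le> 2 * gap n" using gl pk by (simp add: \<delta>'_def)
  \<comment> \<open>As \<open>L \<le> l\<close> and \<open>k \<le> \<kappa>\<close>, the size
    \<open>L ^ k\<close> of the grid is at most
    \<open>exp (\<kappa> * ll) = exp (l / 4)\<close>.\<close>
  have M: "4 * real M \<le> gap n * real n"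
  proof -
    have "L \<le> l" using k(2) \<kappa>(2) by (simp add: L_def)
    then have "ln L \<le> ll" unfolding ll_def using L(1) l by simp
    then have "real k * ln L \<le> \<kappa> * ll"
      using k(2) ll \<kappa>0 by (intro mult_mono) (auto simp: L_def)
    also have "\<dots> = l / 4" using ll by (simp add: \<kappa>_def)
    finally have "exp (real k * ln L) \<le> exp (l / 4)" by simp
    moreover have "real M = exp (real k * ln L)"
      using L(1) by (simp add: M_def L_def exp_of_nat_mult)
    ultimately show ?thesis using gM by linarith
  qed
  have M1: "1 \<le> real M" by (simp add: M_def)
  show ?case
  proof (intro allI impI)
    fix m assume m: "3 * m \<le> n" "4 * (gap n * real n) \<le> real m"
    have \<delta>n: "\<delta>' * real n \<le> 2 * (gap n * real n)"
      using mult_right_mono[OF \<delta>', of "real n"] by simp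
    have \<beta>n: "\<beta> * real n \<le> 1001 * (gap n * real n)"
      using mult_right_mono[OF \<beta>, of "real n"] by simp
    have "\<delta>' * real n + 2 * real M + 1 \<le> real m" using \<delta>n M M1 m(2) by linarith
    then have "(real n)\<^sup>2 / 8 + real m * real n / 3 - real n * (\<delta>' * real n + \<beta> * real n + 4 * real M)
        \<le> real (RT n (complete_graph 4) m)"
      by (intro RT_K4_ge_of_grid[OF k(3) k(3) _ R0 R1 R2 R3 \<delta>'_def \<beta>_def M_def m(1)]) (use l in auto)
    \<comment> \<open>The three errors are at most 2, 1001 and 1 times
      \<open>gap n * real n\<close>; 1010 is a round bound for the total.\<close>
    moreover have "real n * (\<delta>' * real n + \<beta> * real n + 4 * real M) \<le> real n * (1010 * (gap n * real n))"
    proof (rule mult_left_mono)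
      show "\<delta>' * real n + \<beta> * real n + 4 * real M \<le> 1010 * (gap n * real n)"
        using \<delta>n \<beta>n M M1 by linarith
    qed simp
    ultimately show "(real n)\<^sup>2 / 8 + real m * real n / 3 - real n * (1010 * (gap n * real n))
        \<le> real (RT n (complete_graph 4) m)" by linarith
  qed
qed

theorem theorem1p7:
  fixes m :: "nat \<Rightarrow> nat"
  assumes "\<forall>\<^sub>F n in sequentially. real (m n) \<le> real n / 3"
    and "filterlim
           (\<lambda>n. real (m n) / (ln (ln (real n)) powr (3/2) / ln (real n) powr (1/2) * real n))
           at_top sequentially"
  shows "\<exists>\<epsilon> :: nat \<Rightarrow> real. \<epsilon> \<longlonglongrightarrow> 0 \<and>
           (\<forall>\<^sub>F n in sequentially.
              real (RT n (complete_graph 4) (m n))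
                \<ge> (real n)\<^sup>2 / 8 + (1/3 - \<epsilon> n) * real (m n) * real n)"
proof (intro exI conjI)
  \<comment> \<open>The ratio assumed to tend to infinity; \<open>1010 * inverse (f n)\<close>
    expresses the error \<open>1010 * (gap n * real n)\<close> as a multiple of
    \<open>m n\<close>.\<close>
  define f where "f n = real (m n) / (gap n * real n)" for n
  have f: "filterlim f at_top sequentially"
    using assms(2) unfolding f_def gap_def .
  show "(\<lambda>n. 1010 * inverse (f n)) \<longlonglongrightarrow> 0"
    by (intro tendsto_mult_right_zero tendsto_inverse_0_at_top f)
  have "\<forall>\<^sub>F n in sequentially. 4 \<le> f n" using f by (auto simp: filterlim_at_top)
  with assms(1) RT_K4_ge_eventually
  show "\<forall>\<^sub>F n in sequentially. (real n)\<^sup>2 / 8 + (1/3 - 1010 * inverse (f n)) * real (m n) * real n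
      \<le> real (RT n (complete_graph 4) (m n))"
  proof eventually_elim
    case (elim n)
    have "gap n * real n > 0"
    proof -
      have "0 \<le> gap n * real n" by (simp add: gap_def)
      \<comment> \<open>A zero denominator would give \<open>f n = 0\<close>, against
        \<open>4 \<le> f n\<close>.\<close>
      moreover have "gap n * real n \<noteq> 0" using elim(3) unfolding f_def by (metis div_by_0 not_numeral_le_zero)
      ultimately show ?thesis by linarith
    qed
    moreover from this have m: "4 * (gap n * real n) \<le> real (m n)"
      using elim(3) by (simp add: f_def le_divide_eq)
    ultimately have "inverse (f n) * real (m n) = gap n * real n" by (simp add: f_def)
    then have "(1/3 - 1010 * inverse (f n)) * real (m n) * real n
        = real (m n) * real n / 3 - real n * (1010 * (gap n * real n))"
      by (simp add: algebra_simps)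
    moreover have "3 * m n \<le> n" using elim(1) by linarith
    ultimately show ?case using elim(2) m by (simp add: add_diff_eq)
  qed
qed

end
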